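(* Let $(e_j)_{j=1}^n$ be the canonical basis of $\mathbb{R}^n$. For any $k$-dimensional linear subspace $H$ of $\mathbb{R}^n$ such that $e_j\notin H\cup H^\perp$ for every $1\le j\le n$, we have $$\mathrm{vol}_k(B_1^n\cap H)\le\mathrm{vol}_k(B_1^k)\,\frac{1}{\pi^{\frac{n-k}{2}}}\prod_{j=1}^n\left(\frac{\Gamma\left(\frac{1}{\|P_{H^\perp}e_j\|_2^2}-\frac12\right)}{\|P_{H^\perp}e_j\|_2\,\Gamma\left(\frac{1}{\|P_{H^\perp}e_j\|_2^2}\right)}\right)^{\|P_{H^\perp}e_j\|_2^2}\le\mathrm{vol}_k(B_1^k).$$
   Context: $B_1^n$ is the closed unit ball of $\ell_1^n$, and $P_{H^\perp}$ is the orthogonal projection onto the orthogonal complement $H^\perp$ of $H$ in $\mathbb{R}^n$. *)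

theory Defs
  imports "HOL-Analysis.Analysis"
begin

definition ell1_ball :: "(real ^ 'n) set"
  where "ell1_ball = {x. (\<Sum>i\<in>UNIV. \<bar>x $ i\<bar>) \<le> 1}"

definition orth_proj :: "'a::euclidean_space set \<Rightarrow> 'a \<Rightarrow> 'a"
  where "orth_proj S x = (THE y. y \<in> S \<and> x - y \<in> S\<^sup>\<bottom>)"

definition orthonormal_basis_of :: "'a::euclidean_space set \<Rightarrow> 'a set \<Rightarrow> bool"
  where "orthonormal_basis_of B S \<longleftrightarrow>
    pairwise orthogonal B \<and> (\<forall>b\<in>B. norm b = 1) \<and> span B = S"

text \<open>The Lebesgue measure of a linear subspace, in the dimension of that subspace. It is defined
  like \<^const>\<open>lborel\<close>, with the standard basis replaced by an orthonormal basis of the subspace. The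
  choice of the basis does not matter: by \<open>subspace_lborel_eq_distr_isometry\<close> below, this is the
  image of \<^const>\<open>lborel\<close> under every linear isometry from a Euclidean space onto the subspace.\<close>

definition subspace_lborel :: "'a::euclidean_space set \<Rightarrow> 'a measure"
  where "subspace_lborel S =
    (let B = (SOME B. orthonormal_basis_of B S)
     in distr (\<Pi>\<^sub>M b\<in>B. lborel) borel (\<lambda>x. \<Sum>b\<in>B. x b *\<^sub>R b))"

lemma orth_proj_unique:
  assumes "subspace S" "y \<in> S" "x - y \<in> S\<^sup>\<bottom>"
  shows "orth_proj S x = y"
  unfolding orth_proj_def
proof (rule the_equality)
  show "y \<in> S \<and> x - y \<in> S\<^sup>\<bottom>" using assms by simp
  fix z assume z: "z \<in> S \<and> x - z \<in> S\<^sup>\<bottom>"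
  have "z - y \<in> S" using z assms by (simp add: subspace_diff)
  moreover have "(x - y) - (x - z) \<in> S\<^sup>\<bottom>"
    using z assms subspace_orthogonal_comp subspace_diff by blast
  ultimately have "orthogonal (z - y) (z - y)"
    by (simp add: orthogonal_comp_def)
  then show "z = y" by (simp add: orthogonal_self)
qed

lemma
  assumes "subspace S"
  shows orth_proj_in: "orth_proj S x \<in> S"
    and orth_proj_diff: "x - orth_proj S x \<in> S\<^sup>\<bottom>"
proof -
  have "x \<in> S + S\<^sup>\<bottom>" using subspace_sum_orthogonal_comp[OF assms] by simp
  then obtain y z where yz: "x = y + z" "y \<in> S" "z \<in> S\<^sup>\<bottom>" by (rule set_plus_elim)
  then have "orth_proj S x = y" by (intro orth_proj_unique assms) auto
  then show "orth_proj S x \<in> S" "x - orth_proj S x \<in> S\<^sup>\<bottom>" using yz by auto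
qed

lemma ex_orthonormal_basis_of: "subspace S \<Longrightarrow> \<exists>B. orthonormal_basis_of B S"
  by (metis orthonormal_basis_subspace orthonormal_basis_of_def)

lemma orthonormal_basis_of_props:
  assumes "orthonormal_basis_of B S"
  shows "finite B" "independent B" "card B = dim S"
    and "\<And>b c. b \<in> B \<Longrightarrow> c \<in> B \<Longrightarrow> b \<bullet> c = (if b = c then 1 else 0)"
proof -
  have "0 \<notin> B" using assms by (force simp: orthonormal_basis_of_def)
  then show i: "independent B"
    using assms pairwise_orthogonal_independent by (auto simp: orthonormal_basis_of_def)
  then show "finite B" by (rule independent_imp_finite)
  show "card B = dim S"
    using i assms by (metis dim_span_eq_card_independent orthonormal_basis_of_def)
  show "b \<bullet> c = (if b = c then 1 else 0)" if "b \<in> B" "c \<in> B" for b c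
    using assms that
    by (auto simp: orthonormal_basis_of_def pairwise_def orthogonal_def norm_eq_1)
qed

lemma lborel_uminus_euclidean:
  fixes A :: "'a::euclidean_space set"
  assumes [measurable]: "A \<in> sets borel"
  shows "emeasure lborel (uminus -` A) = emeasure lborel A"
proof -
  have "(lborel :: 'a measure) = density (distr lborel borel (\<lambda>x. 0 + (-1) *\<^sub>R x)) (\<lambda>_. ennreal (\<bar>-1\<bar> ^ DIM('a)))"
    by (rule lborel_affine) simp
  then have "(lborel :: 'a measure) = distr lborel borel uminus"
    by (simp add: density_1)
  then have "emeasure lborel A = emeasure (distr lborel borel uminus) A" by simp
  also have "\<dots> = emeasure lborel (uminus -` A)" by (subst emeasure_distr) auto
  finally show ?thesis by simp
qed

lemma nn_integral_translate_invariant: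
  fixes M :: "'a::euclidean_space measure"
  assumes [measurable_cong]: "sets M = sets borel"
    and inv: "\<And>a. distr M borel (\<lambda>x. a + x) = M"
    and [measurable]: "f \<in> borel_measurable borel"
  shows "(\<integral>\<^sup>+x. f (a + x) \<partial>M) = (\<integral>\<^sup>+x. f x \<partial>M)"
proof -
  have "(\<integral>\<^sup>+x. f x \<partial>M) = (\<integral>\<^sup>+x. f x \<partial>distr M borel (\<lambda>x. a + x))" by (simp add: inv)
  also have "\<dots> = (\<integral>\<^sup>+x. f (a + x) \<partial>M)" by (subst nn_integral_distr) auto
  finally show ?thesis by simp
qed

lemma translation_invariant_proportional:
  fixes M :: "'a::euclidean_space measure"
  assumes "sigma_finite_measure M"
    and sets[measurable_cong]: "sets M = sets borel"
    and inv: "\<And>a. distr M borel (\<lambda>x. a + x) = M"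
    and [measurable]: "A \<in> sets borel" "B \<in> sets borel"
  shows "emeasure M A * emeasure lborel B = emeasure lborel A * emeasure M B"
proof -
  interpret M: sigma_finite_measure M by fact
  interpret P: pair_sigma_finite M lborel ..
  let ?A = "indicator A :: 'a \<Rightarrow> ennreal" and ?B = "indicator B :: 'a \<Rightarrow> ennreal"
  have linv: "distr lborel borel (\<lambda>x. a + x) = lborel" for a :: 'a
    by (rule lborel_distr_plus)
  have "emeasure M A * emeasure lborel B = (\<integral>\<^sup>+x. ?A x * emeasure lborel B \<partial>M)"
    by (subst nn_integral_multc) (auto simp: sets)
  also have "\<dots> = (\<integral>\<^sup>+x. ?A x * (\<integral>\<^sup>+y. ?B (x + y) \<partial>lborel) \<partial>M)"
    by (subst nn_integral_translate_invariant[OF _ linv]) auto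
  also have "\<dots> = (\<integral>\<^sup>+x. (\<integral>\<^sup>+y. ?A x * ?B (x + y) \<partial>lborel) \<partial>M)"
    by (subst nn_integral_cmult) auto
  also have "\<dots> = (\<integral>\<^sup>+y. (\<integral>\<^sup>+x. ?A x * ?B (x + y) \<partial>M) \<partial>lborel)"
    by (rule P.Fubini'[symmetric]) measurable
  also have "\<dots> = (\<integral>\<^sup>+y. (\<integral>\<^sup>+x. ?A (x - y) * ?B x \<partial>M) \<partial>lborel)"
  proof (rule nn_integral_cong)
    fix y :: 'a
    show "(\<integral>\<^sup>+x. ?A x * ?B (x + y) \<partial>M) = (\<integral>\<^sup>+x. ?A (x - y) * ?B x \<partial>M)"
      using nn_integral_translate_invariant[OF sets inv, of "\<lambda>x. ?A (x - y) * ?B x" y]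
      by (simp add: add.commute)
  qed
  also have "\<dots> = (\<integral>\<^sup>+x. (\<integral>\<^sup>+y. ?A (x - y) * ?B x \<partial>lborel) \<partial>M)"
    by (rule P.Fubini') measurable
  also have "\<dots> = (\<integral>\<^sup>+x. (\<integral>\<^sup>+y. ?A (x - y) \<partial>lborel) * ?B x \<partial>M)"
    by (subst nn_integral_multc) auto
  also have "\<dots> = (\<integral>\<^sup>+x. emeasure lborel A * ?B x \<partial>M)"
  proof (rule nn_integral_cong)
    fix x :: 'a
    have "(\<integral>\<^sup>+y. ?A (x - y) \<partial>lborel) = (\<integral>\<^sup>+y. ?A (- y) \<partial>lborel)"
      using nn_integral_translate_invariant[OF _ linv, of "\<lambda>y. ?A (x - y)" x] by simp
    also have "\<dots> = (\<integral>\<^sup>+y. indicator (uminus -` A) y \<partial>lborel)"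
      by (simp add: indicator_def)
    also have "\<dots> = emeasure lborel (uminus -` A)"
      by (rule nn_integral_indicator) (simp add: measurable_sets_borel[of uminus borel])
    also have "\<dots> = emeasure lborel A" by (rule lborel_uminus_euclidean) simp
    finally show "(\<integral>\<^sup>+y. ?A (x - y) \<partial>lborel) * ?B x = emeasure lborel A * ?B x" by simp
  qed
  also have "\<dots> = emeasure lborel A * emeasure M B"
    by (subst nn_integral_cmult) (auto simp: sets)
  finally show ?thesis .
qed

lemma lborel_distr_orthogonal:
  fixes T :: "'a::euclidean_space \<Rightarrow> 'a"
  assumes T: "orthogonal_transformation T"
  shows "distr lborel borel T = lborel"
proof -
  have lin: "linear T" using T by (rule orthogonal_transformation_linear)
  then have [measurable]: "T \<in> borel_measurable borel"
    by (intro borel_measurable_continuous_onI linear_continuous_on)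
       (simp add: linear_conv_bounded_linear)
  obtain S where S: "orthogonal_transformation S" "\<And>x. S (T x) = x" "\<And>x. T (S x) = x"
    by (metis T orthogonal_transformation_bij orthogonal_transformation_inv bij_inv_eq_iff)
  have [measurable]: "S \<in> borel_measurable borel"
    using orthogonal_transformation_linear[OF S(1)]
    by (intro borel_measurable_continuous_onI linear_continuous_on)
       (simp add: linear_conv_bounded_linear)
  let ?M = "distr lborel borel T"
  have inv: "distr ?M borel (\<lambda>x. a + x) = ?M" for a
  proof -
    have "distr ?M borel (\<lambda>x. a + x) = distr lborel borel (\<lambda>x. T (S a + x))"
      by (subst distr_distr) (auto simp: o_def linear_add[OF lin] S)
    also have "\<dots> = distr (distr lborel borel (\<lambda>x. S a + x)) borel T"
      by (subst distr_distr) (auto simp: o_def)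
    finally show ?thesis by (simp add: lborel_distr_plus)
  qed
  have cb: "emeasure ?M (cball 0 1) = emeasure lborel (cball (0::'a) 1)"
    using orthogonal_transformation_norm[OF T] by (subst emeasure_distr) (auto simp: vimage_def cball_def)
  have sf: "sigma_finite_measure ?M"
  proof
    let ?F = "range (\<lambda>n::nat. cball (0::'a) (real n))"
    have "T -` cball 0 (real n) = cball 0 (real n)" for n
      using T by (auto simp: orthogonal_transformation_norm)
    then have "emeasure ?M (cball 0 (real n)) \<noteq> \<infinity>" for n
      using emeasure_lborel_cball_finite[of "0::'a" "real n"]
      by (subst emeasure_distr) auto
    moreover have "\<Union>?F = UNIV" by (auto simp: real_arch_simple)
    ultimately show "\<exists>A. countable A \<and> A \<subseteq> sets ?M \<and> \<Union>A = space ?M \<and> (\<forall>a\<in>A. emeasure ?M a \<noteq> \<infinity>)"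
      by (intro exI[of _ ?F]) auto
  qed
  show ?thesis
  proof (rule measure_eqI)
    fix A :: "'a set" assume "A \<in> sets ?M"
    then have "emeasure ?M A * emeasure lborel (cball (0::'a) 1)
        = emeasure lborel A * emeasure lborel (cball (0::'a) 1)"
      using translation_invariant_proportional[OF sf _ inv, of A "cball 0 1"] cb by simp
    moreover have "emeasure lborel (cball (0::'a) 1) \<noteq> \<infinity>"
      using emeasure_lborel_cball_finite[of "0::'a" 1] by simp
    moreover have "emeasure lborel (cball (0::'a) 1) \<noteq> 0"
      by (simp add: emeasure_cball unit_ball_vol_pos less_imp_neq[symmetric])
    ultimately show "emeasure ?M A = emeasure lborel A"
      by (simp add: ennreal_mult_cancel_left mult.commute[of _ "emeasure lborel (cball 0 1)"])
  qed simp
qed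

lemma distr_PiM_lborel_reindex:
  fixes h :: "'i \<Rightarrow> 'j"
  assumes h: "bij_betw h I J" and fin: "finite I"
  shows "distr (\<Pi>\<^sub>M i\<in>I. lborel) (\<Pi>\<^sub>M j\<in>J. lborel :: real measure)
           (\<lambda>x. \<lambda>j\<in>J. x (the_inv_into I h j)) = (\<Pi>\<^sub>M j\<in>J. lborel)"
proof -
  interpret product_sigma_finite "\<lambda>_. lborel :: real measure" ..
  define g where "g = the_inv_into I h"
  have g: "bij_betw g J I" unfolding g_def using h by (rule bij_betw_the_inv_into)
  have gI: "g j \<in> I" if "j \<in> J" for j using g that by (auto simp: bij_betw_def)
  have gh: "g (h i) = i" if "i \<in> I" for i
    using h that by (auto simp: g_def bij_betw_def the_inv_into_f_f)
  have hg: "h (g j) = j" "g j \<in> I" if "j \<in> J" for j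
    using h that gI by (auto simp: g_def f_the_inv_into_f_bij_betw)
  have hJ: "h i \<in> J" if "i \<in> I" for i using h that by (auto simp: bij_betw_def)
  have finJ: "finite J" using h fin bij_betw_finite by blast
  have meas: "(\<lambda>x. \<lambda>j\<in>J. x (g j)) \<in> measurable (\<Pi>\<^sub>M i\<in>I. lborel) (\<Pi>\<^sub>M j\<in>J. lborel :: real measure)"
    by (intro measurable_restrict measurable_component_singleton gI)
  have "distr (\<Pi>\<^sub>M i\<in>I. lborel) (\<Pi>\<^sub>M j\<in>J. lborel :: real measure) (\<lambda>x. \<lambda>j\<in>J. x (g j))
      = (\<Pi>\<^sub>M j\<in>J. lborel)"
  proof (rule PiM_eqI)
    fix A :: "'j \<Rightarrow> real set" assume A: "\<And>i. i \<in> J \<Longrightarrow> A i \<in> sets lborel"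
    have "(\<lambda>x. \<lambda>j\<in>J. x (g j)) -` Pi\<^sub>E J A \<inter> space (\<Pi>\<^sub>M i\<in>I. lborel) = Pi\<^sub>E I (\<lambda>i. A (h i))"
      using hg hJ by (auto simp: space_PiM PiE_iff) (metis gh)+
    then have "emeasure (distr (\<Pi>\<^sub>M i\<in>I. lborel) (\<Pi>\<^sub>M j\<in>J. lborel) (\<lambda>x. \<lambda>j\<in>J. x (g j))) (Pi\<^sub>E J A)
        = emeasure (\<Pi>\<^sub>M i\<in>I. lborel) (Pi\<^sub>E I (\<lambda>i. A (h i)))"
      using A finJ by (subst emeasure_distr[OF meas]) (auto intro!: sets_PiM_I_finite)
    also have "\<dots> = (\<Prod>i\<in>I. emeasure lborel (A (h i)))"
      using A hJ fin by (subst emeasure_PiM) auto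
    also have "\<dots> = (\<Prod>j\<in>J. emeasure lborel (A j))"
      by (rule prod.reindex_bij_betw[OF h])
    finally show "emeasure (distr (\<Pi>\<^sub>M i\<in>I. lborel) (\<Pi>\<^sub>M j\<in>J. lborel) (\<lambda>x. \<lambda>j\<in>J. x (g j))) (Pi\<^sub>E J A)
        = (\<Prod>j\<in>J. emeasure lborel (A j))" .
  qed (use finJ in auto)
  then show ?thesis by (simp add: g_def)
qed

lemma distr_orthonormal_basis_eq_distr_isometry:
  fixes f :: "'b::euclidean_space \<Rightarrow> 'a::euclidean_space"
  assumes B: "orthonormal_basis_of B S"
    and f: "linear f" "\<And>x. norm (f x) = norm x" "range f = S"
  shows "distr (\<Pi>\<^sub>M b\<in>B. lborel) borel (\<lambda>x. \<Sum>b\<in>B. x b *\<^sub>R b) = distr lborel borel f"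
proof -
  note Bp = orthonormal_basis_of_props[OF B]
  have injf: "inj f" using f(1,2) by (metis linear_injective_0 norm_eq_zero)
  have finner: "f x \<bullet> f y = x \<bullet> y" for x y
    by (simp add: dot_norm f(2) flip: linear_add[OF f(1)])
  have "dim S = DIM('b)"
    using dim_image_eq[OF f(1), of UNIV] injf f(3) by (auto simp: inj_on_subset)
  then obtain h :: "'b \<Rightarrow> 'a" where h: "bij_betw h Basis B"
    using finite_same_card_bij[OF finite_Basis Bp(1)] Bp(3) by auto
  have hB: "h i \<in> B" if "i \<in> Basis" for i using h that by (auto simp: bij_betw_def)
  define g where "g x = (\<Sum>i\<in>Basis. (x \<bullet> i) *\<^sub>R h i)" for x
  define T where "T = inv f \<circ> g"
  have gS: "g x \<in> S" for x
  proof -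
    have "g x \<in> span B" unfolding g_def by (intro span_sum span_scale span_base hB)
    then show ?thesis using B by (simp add: orthonormal_basis_of_def)
  qed
  have ling: "linear g"
    by (rule linearI)
       (simp_all add: g_def inner_add_left scaleR_add_left sum.distrib scaleR_sum_right)
  have ginner: "g x \<bullet> g y = x \<bullet> y" for x y
  proof -
    have "h i \<bullet> h j = (if i = j then 1 else 0)" if "i \<in> Basis" "j \<in> Basis" for i j
      using Bp(4)[OF hB[OF that(1)] hB[OF that(2)]] h that by (auto simp: bij_betw_def inj_on_def)
    then have "g x \<bullet> g y = (\<Sum>i\<in>Basis. \<Sum>j\<in>Basis. (x \<bullet> i) * (y \<bullet> j) * (if i = j then 1 else 0))"
      unfolding g_def inner_sum_left inner_sum_right
      by (intro sum.cong refl) simp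
    also have "\<dots> = x \<bullet> y"
      by (simp add: euclidean_inner[of x y] if_distrib sum.delta cong: if_cong)
    finally show ?thesis .
  qed
  have fT: "f (T x) = g x" for x
    using gS[of x] f(3) by (simp add: T_def f_inv_into_f)
  have "orthogonal_transformation T"
    unfolding orthogonal_transformation_def
  proof
    show "linear T"
      by (rule linearI; rule injD[OF injf])
         (simp_all add: fT linear_add[OF f(1)] linear_add[OF ling] linear_scale[OF f(1)] linear_scale[OF ling])
    show "\<forall>v w. T v \<bullet> T w = v \<bullet> w" by (metis fT finner ginner)
  qed
  note T = this lborel_distr_orthogonal[OF this]
  have [measurable]: "T \<in> borel_measurable borel" "f \<in> borel_measurable borel" "g \<in> borel_measurable borel"
    using orthogonal_transformation_linear[OF T(1)] f(1) ling
    by (auto intro!: borel_measurable_continuous_onI linear_continuous_on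
        simp: linear_conv_bounded_linear)
  let ?r = "\<lambda>x. \<lambda>j\<in>B. x (the_inv_into Basis h j) :: real"
  have mr: "?r \<in> measurable (\<Pi>\<^sub>M i\<in>Basis. lborel) (\<Pi>\<^sub>M j\<in>B. lborel)"
    using bij_betw_the_inv_into[OF h]
    by (intro measurable_restrict measurable_component_singleton) (auto simp: bij_betw_def)
  have ms: "(\<lambda>x. \<Sum>b\<in>B. x b *\<^sub>R b) \<in> measurable (\<Pi>\<^sub>M j\<in>B. lborel) borel" by measurable
  have eq: "(\<Sum>b\<in>B. ?r x b *\<^sub>R b) = g (\<Sum>i\<in>Basis. x i *\<^sub>R i)" for x
  proof -
    have "(\<Sum>b\<in>B. ?r x b *\<^sub>R b) = (\<Sum>i\<in>Basis. ?r x (h i) *\<^sub>R h i)"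
      by (rule sum.reindex_bij_betw[OF h, symmetric])
    also have "\<dots> = (\<Sum>i\<in>Basis. x i *\<^sub>R h i)"
      using h hB by (intro sum.cong) (auto simp: bij_betw_def the_inv_into_f_f)
    also have "\<dots> = g (\<Sum>i\<in>Basis. x i *\<^sub>R i)" by (simp add: g_def)
    finally show ?thesis .
  qed
  have "distr (\<Pi>\<^sub>M b\<in>B. lborel) borel (\<lambda>x. \<Sum>b\<in>B. x b *\<^sub>R b)
      = distr (distr (\<Pi>\<^sub>M i\<in>Basis. lborel) (\<Pi>\<^sub>M j\<in>B. lborel) ?r) borel (\<lambda>x. \<Sum>b\<in>B. x b *\<^sub>R b)"
    by (simp add: distr_PiM_lborel_reindex[OF h finite_Basis])
  also have "\<dots> = distr (\<Pi>\<^sub>M i\<in>Basis. lborel) borel (\<lambda>x. g (\<Sum>i\<in>Basis. x i *\<^sub>R i))"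
    by (subst distr_distr[OF ms mr]) (simp add: o_def eq del: restrict_apply)
  also have "\<dots> = distr (distr (\<Pi>\<^sub>M i\<in>Basis. lborel) borel (\<lambda>x. \<Sum>i\<in>Basis. x i *\<^sub>R i)) borel g"
    by (subst distr_distr) (auto simp: o_def)
  also have "\<dots> = distr lborel borel g" by (simp flip: lborel_eq)
  also have "g = f \<circ> T" by (simp add: fun_eq_iff fT)
  also have "distr lborel borel (f \<circ> T) = distr (distr lborel borel T) borel f"
    by (subst distr_distr) auto
  finally show ?thesis by (simp add: T(2))
qed

theorem subspace_lborel_eq_distr_isometry:
  fixes f :: "'b::euclidean_space \<Rightarrow> 'a::euclidean_space"
  assumes "linear f" "\<And>x. norm (f x) = norm x" "range f = S"
  shows "subspace_lborel S = distr lborel borel f"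
proof -
  have "subspace S" using assms linear_subspace_image[OF assms(1) subspace_UNIV] by simp
  then have "orthonormal_basis_of (SOME B. orthonormal_basis_of B S) S"
    using ex_orthonormal_basis_of someI_ex by metis
  from distr_orthonormal_basis_eq_distr_isometry[OF this assms] show ?thesis
    by (simp add: subspace_lborel_def Let_def)
qed

end

theory Submission
  imports Defs "HOL-Probability.Probability" "HOL-Complex_Analysis.Complex_Analysis"
begin

text \<open>
  Let \<open>P\<close> be the orthogonal projection onto \<open>H\<^sup>\<bottom>\<close> and \<open>p\<^sub>j = \<parallel>P e\<^sub>j\<parallel>\<close>. The volume of the unit ball of a
  gauge \<open>N\<close> on a space of dimension \<open>k\<close> is \<open>1 / k!\<close> times the integral of \<open>exp (- N)\<close>
  (\<open>nn_integral_exp_neg_homogeneous\<close>). For the \<open>\<ell>\<^sub>1\<close> norm on the whole of \<open>\<real>\<^sup>k\<close> that integral is \<open>2\<^sup>k\<close>, so the first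
  inequality is an upper bound for the integral over \<open>H\<close> of the product of the functions
  \<open>exp (- \<bar>x\<^sub>j\<bar>)\<close>.

  Each factor is the Fourier transform of the Cauchy kernel \<open>1 / (\<pi> (1 + t\<^sup>2))\<close>. Integrating a
  function over a subspace amounts to integrating its Fourier transform over the orthogonal
  complement, and this turns the question into one about the integral of
  \<open>\<Prod>\<^sub>j 1 / (1 + \<xi>\<^sub>j\<^sup>2)\<close> over \<open>H\<^sup>\<bottom>\<close>. A Gaussian damping \<open>exp (- \<pi> \<delta>\<^sup>2 \<parallel>z\<parallel>\<^sup>2)\<close> on \<open>H\<close> makes the Fubini argument
  absolutely convergent; on the dual side it becomes a Gaussian weight in the direction of \<open>H\<close>, so
  that the integral extends over all of \<open>\<real>\<^sup>n\<close> (\<open>gaussian_section_fourier\<close>). The bound below does not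
  depend on \<open>\<delta>\<close>, and \<open>\<delta> \<rightarrow> 0\<close> is monotone convergence.

  The vectors \<open>P e\<^sub>j / p\<^sub>j\<close> with the weights \<open>p\<^sub>j\<^sup>2\<close> decompose the identity of \<open>H\<^sup>\<bottom>\<close>, which is the situation
  of the geometric Brascamp--Lieb inequality (\<open>brascamp_lieb_projection\<close>). It is applied to the functions
  \<open>(1 + t\<^sup>2) powr (- 1 / p\<^sub>j\<^sup>2)\<close>, whose \<open>p\<^sub>j\<^sup>2\<close>-th powers are the factors above and whose integrals are
  quotients of Gamma values (\<open>nn_integral_cauchy_power\<close>). Its proof is by transport: each function
  is mapped to a Gaussian by a monotone map of the line, the maps are combined into an injective
  map of \<open>\<real>\<^sup>n\<close>, and the Jacobian of that map is at least the weighted geometric mean of the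
  one-dimensional derivatives (\<open>ln_det_compression_ge\<close>). The determinant inequality follows from the
  concavity of the logarithm in an orthonormal eigenbasis.

  For the second inequality, the substitution \<open>t = x / \<surd>s\<close> in the integral of \<open>(1 + t\<^sup>2) powr (- s)\<close> and
  Bernoulli's inequality \<open>1 + x\<^sup>2 \<le> (1 + x\<^sup>2 / s) powr s\<close> show that each factor is largest when
  \<open>p\<^sub>j = 1\<close> (\<open>Gamma_quotient_le\<close>); since \<open>\<Sum>\<^sub>j p\<^sub>j\<^sup>2 = n - k\<close>, the product is at most
  \<open>\<pi> powr ((n - k) / 2)\<close>.
\<close>

section \<open>Volume as a Laplace integral\<close>

lemma emeasure_lborel_vimage_scaleR:
  assumes "t > 0" and [measurable]: "A \<in> sets borel"
  shows "emeasure lborel {x :: 'a::euclidean_space. (1 / t) *\<^sub>R x \<in> A} = ennreal (t ^ DIM('a)) * emeasure lborel A"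
proof -
  have "(lborel :: 'a measure) = density (distr lborel borel (\<lambda>x. 0 + t *\<^sub>R x)) (\<lambda>_. ennreal (\<bar>t\<bar> ^ DIM('a)))"
    by (rule lborel_affine) (use assms in auto)
  then have "emeasure (lborel :: 'a measure) {x. (1 / t) *\<^sub>R x \<in> A} = emeasure (density (distr lborel borel (\<lambda>x::'a. t *\<^sub>R x)) (\<lambda>_. ennreal (t ^ DIM('a)))) {x. (1 / t) *\<^sub>R x \<in> A}"
    using assms by simp
  also have "\<dots> = ennreal (t ^ DIM('a)) * emeasure (distr lborel borel (\<lambda>x::'a. t *\<^sub>R x)) {x. (1 / t) *\<^sub>R x \<in> A}"
    by (subst emeasure_density) (auto simp: nn_integral_cmult)
  also have "emeasure (distr lborel borel (\<lambda>x::'a. t *\<^sub>R x)) {x. (1 / t) *\<^sub>R x \<in> A} = emeasure lborel A"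
    using assms by (subst emeasure_distr) (auto intro!: arg_cong2[where f=emeasure])
  finally show ?thesis .
qed

text \<open>Write \<open>exp (- N x)\<close> as the integral of \<open>exp (- t)\<close> over \<open>t \<ge> N x\<close> and exchange the integrals: the
  sublevel set of height \<open>t\<close> has \<open>t\<^sup>d\<close> times the volume of the unit ball of \<open>N\<close>, and \<open>t\<^sup>d exp (- t)\<close>
  integrates to \<open>d!\<close>.\<close>

lemma nn_integral_exp_neg_homogeneous:
  fixes N :: "'a::euclidean_space \<Rightarrow> real"
  assumes [measurable]: "N \<in> borel_measurable borel" and nn: "\<And>x. N x \<ge> 0"
    and hom: "\<And>t x. t > 0 \<Longrightarrow> N (t *\<^sub>R x) = t * N x"
  shows "(\<integral>\<^sup>+x. ennreal (exp (- N x)) \<partial>lborel) = ennreal (fact DIM('a)) * emeasure lborel {x. N x \<le> 1}"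
proof -
  have ex: "ennreal (exp (- N x)) = (\<integral>\<^sup>+t. ennreal (exp (-t)) * indicator {0<..} t * indicator {x. N x \<le> t} x \<partial>lborel)" for x
  proof -
    have "(\<integral>\<^sup>+t. ennreal (exp (-t)) * indicator {N x ..} t \<partial>lborel) = ennreal (0 - (- exp (- N x)))"
    proof (rule nn_integral_FTC_atLeast)
      have "((\<lambda>t::real. exp (-t)) \<longlongrightarrow> 0) at_top"
        by (rule filterlim_compose[OF exp_at_bot filterlim_uminus_at_bot_at_top])
      then show "((\<lambda>t::real. - exp (-t)) \<longlongrightarrow> 0) at_top" using tendsto_minus by fastforce
    qed (auto intro!: derivative_eq_intros)
    then have "ennreal (exp (- N x)) = (\<integral>\<^sup>+t. ennreal (exp (-t)) * indicator {N x ..} t \<partial>lborel)" by simp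
    also have "\<dots> = (\<integral>\<^sup>+t. ennreal (exp (-t)) * indicator {0<..} t * indicator {x. N x \<le> t} x \<partial>lborel)"
    proof (rule nn_integral_cong_AE)
      have "AE t in lborel. (t::real) \<noteq> 0" by (rule AE_lborel_singleton)
      then show "AE t in lborel. ennreal (exp (-t)) * indicator {N x ..} t =
          ennreal (exp (-t)) * indicator {0<..} t * indicator {x. N x \<le> t} x"
        by eventually_elim (use nn[of x] in \<open>auto simp: indicator_def\<close>)
    qed
    finally show ?thesis .
  qed
  have "(\<integral>\<^sup>+x. ennreal (exp (- N x)) \<partial>lborel)
      = (\<integral>\<^sup>+x. (\<integral>\<^sup>+t. ennreal (exp (-t)) * indicator {0<..} t * indicator {x. N x \<le> t} x \<partial>lborel) \<partial>lborel)"
    by (simp only: ex)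
  also have "\<dots> = (\<integral>\<^sup>+t. (\<integral>\<^sup>+x. ennreal (exp (-t)) * indicator {0<..} t * indicator {x. N x \<le> t} x \<partial>lborel) \<partial>lborel)"
    by (rule lborel_pair.Fubini') (simp add: indicator_def)
  also have "\<dots> = (\<integral>\<^sup>+t. ennreal (t ^ DIM('a) * exp (-t)) * indicator {0 ..} t * emeasure lborel {x. N x \<le> 1} \<partial>lborel)"
  proof (rule nn_integral_cong)
    fix t :: real
    show "(\<integral>\<^sup>+x. ennreal (exp (-t)) * indicator {0<..} t * indicator {x. N x \<le> t} x \<partial>lborel)
      = ennreal (t ^ DIM('a) * exp (-t)) * indicator {0 ..} t * emeasure lborel {x. N x \<le> 1}"
    proof (cases "t > 0")
      case True
      have "{x. N x \<le> t} = {x. (1 / t) *\<^sub>R x \<in> {x. N x \<le> 1}}"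
        using True hom[of t "(1/t) *\<^sub>R _"] by (auto simp: hom)
      then have "emeasure lborel {x. N x \<le> t} = ennreal (t ^ DIM('a)) * emeasure lborel {x. N x \<le> 1}"
        using emeasure_lborel_vimage_scaleR[OF True, of "{x. N x \<le> 1}"] by simp
      moreover have "(\<integral>\<^sup>+x. ennreal (exp (-t)) * indicator {0<..} t * indicator {x. N x \<le> t} x \<partial>lborel)
         = ennreal (exp (-t)) * emeasure lborel {x. N x \<le> t}"
        using True by (subst nn_integral_cmult) auto
      ultimately show ?thesis using True by (simp add: ennreal_mult mult_ac)
    qed (auto simp: indicator_def)
  qed
  also have "\<dots> = ennreal (fact DIM('a)) * emeasure lborel {x. N x \<le> 1}"
    by (subst nn_integral_multc) (auto simp: nn_intergal_power_times_exp_Ici)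
  finally show ?thesis .
qed

section \<open>Product integrals on coordinate space\<close>

lemma lborel_vec_eq:
  "(lborel :: (real ^ 'n) measure) = distr (\<Pi>\<^sub>M i\<in>UNIV. lborel) borel (\<lambda>x. \<chi> i. x i)"
proof -
  let ?h = "\<lambda>i::'n. axis i (1::real)"
  have h: "bij_betw ?h UNIV Basis"
    by (auto simp: bij_betw_def inj_on_def Basis_vec_def axis_eq_axis)
  let ?r = "\<lambda>x. \<lambda>j\<in>Basis. x (the_inv_into UNIV ?h j) :: real"
  have mr: "?r \<in> measurable (\<Pi>\<^sub>M i\<in>UNIV. lborel) (\<Pi>\<^sub>M j\<in>Basis. lborel)"
    by (intro measurable_restrict measurable_component_singleton) auto
  have eq: "(\<Sum>b\<in>Basis. ?r x b *\<^sub>R b) = (\<chi> i. x i)" for x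
  proof -
    have "(\<Sum>b\<in>Basis. ?r x b *\<^sub>R b) = (\<Sum>i\<in>UNIV. ?r x (?h i) *\<^sub>R ?h i)"
      by (rule sum.reindex_bij_betw[OF h, symmetric])
    also have "\<dots> = (\<Sum>i\<in>UNIV. x i *\<^sub>R ?h i)"
      by (intro sum.cong refl) (use h the_inv_into_f_f[of ?h UNIV] in \<open>auto simp: bij_betw_def\<close>)
    also have "\<dots> = (\<chi> i. x i)"
      by (simp add: vec_eq_iff axis_def if_distrib cong: if_cong)
    finally show ?thesis .
  qed
  have "(lborel :: (real ^ 'n) measure)
      = distr (distr (\<Pi>\<^sub>M i\<in>UNIV. lborel) (\<Pi>\<^sub>M j\<in>Basis. lborel) ?r) borel (\<lambda>x. \<Sum>b\<in>Basis. x b *\<^sub>R b)"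
    by (simp add: distr_PiM_lborel_reindex[OF h] lborel_eq[symmetric])
  also have "\<dots> = distr (\<Pi>\<^sub>M i\<in>UNIV. lborel) borel (\<lambda>x. \<chi> i. x i)"
    by (subst distr_distr[OF _ mr]) (simp_all add: o_def eq del: restrict_apply)
  finally show ?thesis .
qed

lemma measurable_vec_lambda:
  "(\<lambda>x. (\<chi> i. x i) :: real ^ 'n) \<in> measurable (\<Pi>\<^sub>M i\<in>UNIV. lborel) borel"
proof (rule borel_measurable_euclidean_space[THEN iffD2, rule_format])
  fix b :: "real ^ 'n" assume "b \<in> Basis"
  then obtain i where "b = axis i 1" by (auto simp: Basis_vec_def)
  then show "(\<lambda>x. (\<chi> i. x i) \<bullet> b) \<in> borel_measurable (\<Pi>\<^sub>M i\<in>UNIV. lborel)"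
    by (simp add: inner_axis)
qed

lemma borel_measurable_vec_nth [measurable]: "(\<lambda>x :: real ^ 'n. x $ i) \<in> borel_measurable borel"
  by (intro borel_measurable_continuous_onI continuous_intros)

interpretation lborel_prod: product_sigma_finite "\<lambda>_. lborel :: real measure" ..

lemma nn_integral_prod_vec:
  assumes [measurable]: "\<And>i. f i \<in> borel_measurable borel"
  shows "(\<integral>\<^sup>+x. (\<Prod>i\<in>UNIV. f i (x $ i)) \<partial>(lborel :: (real ^ 'n) measure)) = (\<Prod>i\<in>UNIV. \<integral>\<^sup>+t. f i t \<partial>lborel)"
  unfolding lborel_vec_eq
  by (subst nn_integral_distr[OF measurable_vec_lambda])
     (auto intro!: lborel_prod.product_nn_integral_prod)

lemma integrable_prod_vec:
  fixes f :: "'n::finite \<Rightarrow> real \<Rightarrow> 'a::{real_normed_field,banach,second_countable_topology}"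
  assumes "\<And>i. integrable lborel (f i)"
  shows "integrable (lborel :: (real ^ 'n) measure) (\<lambda>x. \<Prod>i\<in>UNIV. f i (x $ i))"
proof -
  have [measurable]: "f i \<in> borel_measurable borel" for i using assms[of i] by auto
  show ?thesis
    unfolding lborel_vec_eq
    by (subst integrable_distr_eq[OF measurable_vec_lambda])
       (auto intro!: lborel_prod.product_integrable_prod assms)
qed

lemma integral_prod_vec:
  fixes f :: "'n::finite \<Rightarrow> real \<Rightarrow> 'a::{real_normed_field,banach,second_countable_topology}"
  assumes "\<And>i. integrable lborel (f i)"
  shows "(\<integral>x. (\<Prod>i\<in>UNIV. f i (x $ i)) \<partial>(lborel :: (real ^ 'n) measure)) = (\<Prod>i\<in>UNIV. \<integral>t. f i t \<partial>lborel)"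
proof -
  have [measurable]: "f i \<in> borel_measurable borel" for i using assms[of i] by auto
  show ?thesis
    unfolding lborel_vec_eq
    by (subst integral_distr[OF measurable_vec_lambda])
       (auto intro!: lborel_prod.product_integral_prod assms)
qed

lemma norm_vec_square: "(norm (x :: real ^ 'n))\<^sup>2 = (\<Sum>j\<in>UNIV. (x $ j)\<^sup>2)"
  unfolding power2_norm_eq_inner inner_vec_def by (simp add: power2_eq_square)

section \<open>Gaussian and Cauchy integrals on the line\<close>

text \<open>The characteristic function of the standard normal distribution, rescaled so that \<open>\<delta> = 1\<close> gives a
  density of total mass one.\<close>

lemma gaussian_fourier:
  fixes \<delta> w :: real
  assumes "\<delta> > 0"
  shows "integrable lborel (\<lambda>z. complex_of_real (exp (- pi * \<delta>\<^sup>2 * z\<^sup>2)) * iexp (z * w))" (is ?int)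
    and "(\<integral>z. complex_of_real (exp (- pi * \<delta>\<^sup>2 * z\<^sup>2)) * iexp (z * w) \<partial>lborel)
      = complex_of_real (exp (- w\<^sup>2 / (4 * pi * \<delta>\<^sup>2)) / \<delta>)" (is ?eq)
proof -
  define c where "c = sqrt (2 * pi) * \<delta>"
  have c: "c > 0" "c\<^sup>2 = 2 * pi * \<delta>\<^sup>2" using assms by (simp_all add: c_def power_mult_distrib)
  have dens: "std_normal_density (c * z) = exp (- pi * \<delta>\<^sup>2 * z\<^sup>2) / sqrt (2 * pi)" for z
    by (simp add: std_normal_density_def power_mult_distrib c)
  have "integrable lborel (\<lambda>z. std_normal_density (0 + c * z))"
    by (intro lborel_integrable_real_affine integrable_normal_density) (use c in auto)
  then have "integrable lborel (\<lambda>z. exp (- pi * \<delta>\<^sup>2 * z\<^sup>2))"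
    by (simp add: dens divide_real_def del: times_divide_eq_left)
  then show ?int
    by (rule Bochner_Integration.integrable_bound) (auto simp: norm_mult)
  have "complex_of_real (exp (- (w / c)\<^sup>2 / 2)) = char std_normal_distribution (w / c)"
    by (simp add: char_std_normal_distribution)
  also have "\<dots> = (\<integral>x. std_normal_density x *\<^sub>R iexp (w / c * x) \<partial>lborel)"
    unfolding char_def by (subst integral_density) (auto simp: normal_density_nonneg)
  also have "\<dots> = c *\<^sub>R (\<integral>z. std_normal_density (0 + c * z) *\<^sub>R iexp (w / c * (0 + c * z)) \<partial>lborel)"
    by (subst lborel_integral_real_affine[where c=c and t=0]) (use c in auto)
  also have "(\<lambda>z. std_normal_density (0 + c * z) *\<^sub>R iexp (w / c * (0 + c * z)))
     = (\<lambda>z. (1 / sqrt (2 * pi)) *\<^sub>R (complex_of_real (exp (- pi * \<delta>\<^sup>2 * z\<^sup>2)) * iexp (z * w)))"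
  proof
    fix z
    have "w / c * (0 + c * z) = z * w" using c by simp
    then show "std_normal_density (0 + c * z) *\<^sub>R iexp (w / c * (0 + c * z))
     = (1 / sqrt (2 * pi)) *\<^sub>R (complex_of_real (exp (- pi * \<delta>\<^sup>2 * z\<^sup>2)) * iexp (z * w))"
      by (simp only: add_0_left dens scaleR_conv_of_real of_real_divide of_real_mult) simp
  qed
  also have "c *\<^sub>R (\<integral>z. (1 / sqrt (2 * pi)) *\<^sub>R (complex_of_real (exp (- pi * \<delta>\<^sup>2 * z\<^sup>2)) * iexp (z * w)) \<partial>lborel)
    = \<delta> *\<^sub>R (\<integral>z. complex_of_real (exp (- pi * \<delta>\<^sup>2 * z\<^sup>2)) * iexp (z * w) \<partial>lborel)"
    by (simp add: c_def)
  finally have "(\<integral>z. complex_of_real (exp (- pi * \<delta>\<^sup>2 * z\<^sup>2)) * iexp (z * w) \<partial>lborel)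
    = (1 / \<delta>) *\<^sub>R complex_of_real (exp (- (w / c)\<^sup>2 / 2))"
    using assms by simp
  moreover have "(w / c)\<^sup>2 / 2 = w\<^sup>2 / (4 * pi * \<delta>\<^sup>2)" by (simp add: power_divide c)
  ultimately show ?eq by (simp add: scaleR_conv_of_real)
qed

lemma gaussian_nn_integral:
  assumes "u > 0"
  shows "(\<integral>\<^sup>+t. ennreal (exp (- u * t\<^sup>2)) \<partial>lborel) = ennreal (sqrt (pi / u))"
proof -
  define \<delta> where "\<delta> = sqrt (u / pi)"
  have \<delta>: "\<delta> > 0" "pi * \<delta>\<^sup>2 = u" using assms by (simp_all add: \<delta>_def)
  note G = gaussian_fourier[OF \<delta>(1), of 0]
  have i: "integrable lborel (\<lambda>t. exp (- u * t\<^sup>2))"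
    using integrable_Re[OF G(1)] by (simp add: \<delta>)
  have "complex_of_real (\<integral>t. exp (- u * t\<^sup>2) \<partial>lborel) = complex_of_real (1 / \<delta>)"
    using G(2) by (simp add: \<delta>)
  then have "(\<integral>t. exp (- u * t\<^sup>2) \<partial>lborel) = 1 / \<delta>" unfolding of_real_eq_iff .
  also have "1 / \<delta> = sqrt (pi / u)" by (simp add: \<delta>_def real_sqrt_divide)
  finally show ?thesis using i by (subst nn_integral_eq_integral) auto
qed

lemma nn_integral_powr_exp_scaled:
  assumes "s > 0" "c > 0"
  shows "(\<integral>\<^sup>+u. ennreal (indicator {0..} u * u powr (s - 1) * exp (- c * u)) \<partial>lborel) = ennreal (Gamma s * c powr (- s))"
proof -
  have "ennreal (Gamma s) = (\<integral>\<^sup>+u. ennreal (indicator {0..} u * u powr (s - 1) / exp u) \<partial>lborel)"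
    by (rule Gamma_conv_nn_integral_real) fact
  also have "\<dots> = ennreal c * (\<integral>\<^sup>+u. ennreal (indicator {0..} (0 + c * u) * (0 + c * u) powr (s - 1) / exp (0 + c * u)) \<partial>lborel)"
    using assms by (subst nn_integral_real_affine[where c=c and t=0]) auto
  also have "\<dots> = ennreal c * (\<integral>\<^sup>+u. ennreal (c powr (s - 1)) * ennreal (indicator {0..} u * u powr (s - 1) * exp (- c * u)) \<partial>lborel)"
    using assms by (intro arg_cong2[where f="(*)"] nn_integral_cong refl)
       (auto simp: indicator_def ennreal_mult[symmetric] powr_mult exp_minus field_simps zero_le_mult_iff)
  also have "\<dots> = ennreal (c powr s) * (\<integral>\<^sup>+u. ennreal (indicator {0..} u * u powr (s - 1) * exp (- c * u)) \<partial>lborel)"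
    using assms by (subst nn_integral_cmult) (auto simp: mult.assoc[symmetric] ennreal_mult[symmetric] powr_diff)
  finally have "ennreal (c powr (- s)) * ennreal (Gamma s) = ennreal (c powr (- s)) * (ennreal (c powr s) * (\<integral>\<^sup>+u. ennreal (indicator {0..} u * u powr (s - 1) * exp (- c * u)) \<partial>lborel))"
    by simp
  also have "\<dots> = (\<integral>\<^sup>+u. ennreal (indicator {0..} u * u powr (s - 1) * exp (- c * u)) \<partial>lborel)"
    using assms by (simp add: mult.assoc[symmetric] ennreal_mult[symmetric] powr_add[symmetric])
  finally show ?thesis using assms by (simp add: ennreal_mult[symmetric] Gamma_real_pos less_imp_le mult.commute)
qed

text \<open>The power is a mixture of Gaussians: by the scaled Gamma integral,
  \<open>\<Gamma>(s) (1 + t\<^sup>2) powr (- s)\<close> is the integral of \<open>u powr (s - 1) * exp (- (1 + t\<^sup>2) u)\<close> over \<open>u\<close>.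
  Integrating first in \<open>t\<close> leaves the Gamma integral at \<open>s - 1 / 2\<close>.\<close>

lemma nn_integral_cauchy_power:
  assumes "s > 1 / 2"
  shows "(\<integral>\<^sup>+t. ennreal ((1 + t\<^sup>2) powr (- s)) \<partial>lborel) = ennreal (sqrt pi * Gamma (s - 1 / 2) / Gamma s)"
proof -
  have s: "s > 0" "s - 1/2 > 0" using assms by auto
  have G: "Gamma s > 0" "Gamma (s - 1/2) > 0" using s by (auto intro: Gamma_real_pos)
  have 1: "0 < 1 + t\<^sup>2" for t :: real using zero_le_power2[of t] by linarith
  let ?f = "\<lambda>u t. ennreal (indicator {0..} u * u powr (s - 1) * exp (- (1 + t\<^sup>2) * u))"
  have "ennreal (Gamma s) * (\<integral>\<^sup>+t. ennreal ((1 + t\<^sup>2) powr (- s)) \<partial>lborel)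
     = (\<integral>\<^sup>+t. ennreal (Gamma s * (1 + t\<^sup>2) powr (- s)) \<partial>lborel)"
    using G by (subst nn_integral_cmult[symmetric]) (auto simp: ennreal_mult)
  also have "\<dots> = (\<integral>\<^sup>+t. (\<integral>\<^sup>+u. ?f u t \<partial>lborel) \<partial>lborel)"
    by (intro nn_integral_cong nn_integral_powr_exp_scaled[symmetric] s 1)
  also have "\<dots> = (\<integral>\<^sup>+u. (\<integral>\<^sup>+t. ?f u t \<partial>lborel) \<partial>lborel)"
    by (rule lborel_pair.Fubini') simp
  also have "\<dots> = (\<integral>\<^sup>+u. ennreal (sqrt pi) * ennreal (indicator {0..} u * u powr (s - 1/2 - 1) * exp (- 1 * u)) \<partial>lborel)"
  proof (rule nn_integral_cong)
    fix u :: real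
    show "(\<integral>\<^sup>+t. ?f u t \<partial>lborel) = ennreal (sqrt pi) * ennreal (indicator {0..} u * u powr (s - 1/2 - 1) * exp (- 1 * u))"
    proof (cases "u > 0")
      case True
      have "(\<integral>\<^sup>+t. ?f u t \<partial>lborel) = (\<integral>\<^sup>+t. ennreal (u powr (s - 1) * exp (- u)) * ennreal (exp (- u * t\<^sup>2)) \<partial>lborel)"
        using True by (intro nn_integral_cong) (auto simp: ennreal_mult[symmetric] distrib_left mult_exp_exp mult_ac right_diff_distrib)
      also have "\<dots> = ennreal (u powr (s - 1) * exp (- u)) * ennreal (sqrt (pi / u))"
        by (subst nn_integral_cmult) (auto simp: gaussian_nn_integral[OF True, simplified])
      also have "\<dots> = ennreal (sqrt pi) * ennreal (indicator {0..} u * u powr (s - 1/2 - 1) * exp (- 1 * u))"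
      proof -
        have "u powr (s - 1) / sqrt u = u powr (s - 1/2 - 1)"
          using True by (simp add: powr_half_sqrt[symmetric] powr_diff[symmetric])
        then show ?thesis using True by (simp add: ennreal_mult[symmetric] real_sqrt_divide field_simps)
      qed
      finally show ?thesis .
    next
      case False
      then show ?thesis by (cases "u = 0") auto
    qed
  qed
  also have "\<dots> = ennreal (sqrt pi) * ennreal (Gamma (s - 1/2) * 1 powr (- (s - 1/2)))"
    using s by (subst nn_integral_cmult) (auto simp: nn_integral_powr_exp_scaled[of "s - 1/2" 1, simplified])
  finally have "ennreal (Gamma s) * (\<integral>\<^sup>+t. ennreal ((1 + t\<^sup>2) powr (- s)) \<partial>lborel) = ennreal (sqrt pi * Gamma (s - 1/2))"
    using G by (simp add: ennreal_mult[symmetric])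
  then have "ennreal (1 / Gamma s) * (ennreal (Gamma s) * (\<integral>\<^sup>+t. ennreal ((1 + t\<^sup>2) powr (- s)) \<partial>lborel)) = ennreal (1 / Gamma s) * ennreal (sqrt pi * Gamma (s - 1/2))"
    by simp
  then show ?thesis using G by (simp add: mult.assoc[symmetric] ennreal_mult[symmetric])
qed

text \<open>After the substitution \<open>t = x / \<surd>s\<close> in the integral formula for the quotient, Bernoulli's
  inequality bounds the integrand by its value at \<open>s = 1\<close>, whose integral is \<open>\<pi>\<close>. So the bound
  compares the quotient with its value at \<open>s = 1\<close>, where equality holds.\<close>

lemma Gamma_quotient_le:
  assumes "s \<ge> 1"
  shows "sqrt s * Gamma (s - 1 / 2) / Gamma s \<le> sqrt pi"
proof -
  have G: "Gamma s > 0" "Gamma (s - 1/2) > 0" using assms by (auto intro: Gamma_real_pos)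
  have "ennreal (sqrt pi * Gamma (s - 1 / 2) / Gamma s) = (\<integral>\<^sup>+t. ennreal ((1 + t\<^sup>2) powr (- s)) \<partial>lborel)"
    using assms by (subst nn_integral_cauchy_power) auto
  also have "\<dots> = ennreal (1 / sqrt s) * (\<integral>\<^sup>+x. ennreal ((1 + (0 + (1 / sqrt s) * x)\<^sup>2) powr (- s)) \<partial>lborel)"
    using assms by (subst nn_integral_real_affine[where c="1 / sqrt s" and t=0]) auto
  also have "(\<integral>\<^sup>+x. ennreal ((1 + (0 + (1 / sqrt s) * x)\<^sup>2) powr (- s)) \<partial>lborel) \<le> (\<integral>\<^sup>+x. ennreal ((1 + x\<^sup>2) powr (- 1)) \<partial>lborel)"
  proof (intro nn_integral_mono ennreal_leI)
    fix x :: real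
    have "1 + s * (x\<^sup>2 / s) \<le> (1 + x\<^sup>2 / s) powr s"
    proof -
      have "(1 + x\<^sup>2) powr (1 / s) * 1 powr (1 - 1 / s) \<le> (1 / s) * (1 + x\<^sup>2) + (1 - 1 / s) * 1"
        using assms by (intro Youngs_inequality_0) (auto simp: add_pos_nonneg)
      then have "(1 + x\<^sup>2) powr (1 / s) \<le> 1 + x\<^sup>2 / s"
        using assms by (simp add: distrib_left)
      then have "((1 + x\<^sup>2) powr (1 / s)) powr s \<le> (1 + x\<^sup>2 / s) powr s"
        using assms by (intro powr_mono2) auto
      then show ?thesis using assms by (simp add: powr_powr)
    qed
    then have "1 + x\<^sup>2 \<le> (1 + x\<^sup>2 / s) powr s" using assms by simp
    moreover have "1 + x\<^sup>2 > 0" using zero_le_power2[of x] by linarith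
    ultimately have "inverse ((1 + x\<^sup>2 / s) powr s) \<le> inverse (1 + x\<^sup>2)" by (intro le_imp_inverse_le)
    then show "(1 + (0 + (1 / sqrt s) * x)\<^sup>2) powr (- s) \<le> (1 + x\<^sup>2) powr (- 1)"
      using assms \<open>1 + x\<^sup>2 > 0\<close> by (simp add: powr_minus power_divide)
  qed
  also have "(\<integral>\<^sup>+x. ennreal ((1 + x\<^sup>2) powr (- 1)) \<partial>lborel) = ennreal pi"
    using nn_integral_cauchy_power[of 1] by (simp add: Gamma_one_half_real)
  finally have "ennreal (sqrt pi * Gamma (s - 1 / 2) / Gamma s) \<le> ennreal (1 / sqrt s * pi)"
    using assms by (simp add: mult_left_mono ennreal_mult[symmetric])
  then have "sqrt pi * Gamma (s - 1 / 2) / Gamma s \<le> 1 / sqrt s * pi"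
    using assms by (simp add: ennreal_le_iff)
  then have "sqrt pi * (sqrt s * Gamma (s - 1 / 2) / Gamma s) \<le> sqrt pi * sqrt pi"
    using assms by (simp add: field_simps)
  then show ?thesis by (rule mult_left_le_imp_le) simp
qed

lemma integrable_inverse_1_plus_square:
  "integrable lborel (\<lambda>t::real. 1 / (1 + t\<^sup>2))"
  "(\<integral>t. 1 / (1 + t\<^sup>2) \<partial>lborel) = pi"
proof -
  have eq: "(1 + t\<^sup>2) powr (- 1) = 1 / (1 + t\<^sup>2)" for t :: real
    using zero_le_power2[of t] by (simp add: powr_minus add_pos_nonneg divide_inverse)
  have "(\<integral>\<^sup>+t. ennreal (1 / (1 + t\<^sup>2)) \<partial>lborel) = ennreal pi"
    using nn_integral_cauchy_power[of 1] unfolding eq by (simp add: Gamma_one_half_real)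
  then show "integrable lborel (\<lambda>t::real. 1 / (1 + t\<^sup>2))" "(\<integral>t. 1 / (1 + t\<^sup>2) \<partial>lborel) = pi"
    using nn_integral_eq_integrable[of "\<lambda>t::real. 1 / (1 + t\<^sup>2)" lborel pi] by auto
qed

text \<open>Subtracting the constant \<open>exp (- a)\<close> from the numerator removes the pole at \<open>\<i>\<close>, the only one in the
  upper half-plane. Cauchy's theorem on the convex set \<open>Im z > - 1\<close> therefore identifies the integral over the
  segment with minus the integral over the half circle of radius \<open>R\<close>, where the integrand is at most
  \<open>2 / (R\<^sup>2 - 1)\<close>.\<close>

lemma norm_truncated_fourier_cauchy_le:
  fixes a R :: real
  assumes a: "a \<ge> 0" and R: "R > 1"
  shows "norm (\<integral>x\<in>{-R..R}. (iexp (a * x) - of_real (exp (- a))) / of_real (1 + x\<^sup>2) \<partial>lborel) \<le> 2 * pi * R / (R\<^sup>2 - 1)"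
proof -
  define f where "f z = exp (\<i> * of_real a * z)" for z
  define q where "q z = (if z = \<i> then deriv f \<i> else (f z - f \<i>) / (z - \<i>))" for z
  define F where "F z = q z / (z + \<i>)" for z
  let ?S = "{z. Im z > -1}"
  have "\<i> * of_real a * \<i> = complex_of_real (- a)" by (simp add: complex_eq_iff)
  then have fi: "f \<i> = of_real (exp (- a))" by (simp only: f_def exp_of_real)
  have "f holomorphic_on ?S" unfolding f_def by (intro holomorphic_intros)
  then have "q holomorphic_on ?S" unfolding q_def
    by (rule pole_lemma_open) (rule open_halfspace_Im_gt)
  then have "F holomorphic_on ?S" unfolding F_def
    by (intro holomorphic_intros) (auto simp: complex_eq_iff)
  then have Fh: "(F has_contour_integral 0) (linepath (of_real (-R)) (of_real R) +++ part_circlepath 0 R 0 pi)"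
  proof (rule Cauchy_theorem_convex_simple)
    show "convex ?S" by (rule convex_halfspace_Im_gt)
    show "path_image (linepath (of_real (-R)) (of_real R) +++ part_circlepath 0 R 0 pi) \<subseteq> ?S"
    proof (rule subset_path_image_join)
      have "closed_segment (complex_of_real (-R)) (of_real R) \<subseteq> ?S"
        by (rule closed_segment_subset) (auto simp: convex_halfspace_Im_gt)
      then show "path_image (linepath (of_real (-R)) (of_real R)) \<subseteq> ?S" by simp
      show "path_image (part_circlepath 0 R 0 pi) \<subseteq> ?S"
      proof
        fix z assume "z \<in> path_image (part_circlepath 0 R 0 pi)"
        then obtain t where "0 \<le> t" "t \<le> pi" "z = R * cis t"
          by (auto simp: path_image_part_circlepath' cis_conv_exp closed_segment_eq_real_ivl)
        then have "Im z \<ge> 0" using R by (auto intro!: mult_nonneg_nonneg sin_ge_zero)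
        then show "z \<in> ?S" by simp
      qed
    qed
  qed (use R in \<open>auto simp: exp_Euler\<close>)
  have vp: "valid_path (linepath (of_real (-R)) (of_real R :: complex))" "valid_path (part_circlepath 0 R 0 pi)"
    by auto
  have "F contour_integrable_on linepath (of_real (-R)) (of_real R)" "F contour_integrable_on part_circlepath 0 R 0 pi"
    using Fh vp has_contour_integral_integrable contour_integrable_join by (metis R pathstart_part_circlepath pathfinish_linepath has_contour_integral_integrable valid_path_join contour_integrable_joinD1 contour_integrable_joinD2)+
  then obtain I J where I: "(F has_contour_integral I) (linepath (of_real (-R)) (of_real R))"
    and J: "(F has_contour_integral J) (part_circlepath 0 R 0 pi)"
    by (auto simp: contour_integrable_on_def)
  have "(F has_contour_integral (I + J)) (linepath (of_real (-R)) (of_real R) +++ part_circlepath 0 R 0 pi)"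
    by (rule has_contour_integral_join[OF I J vp])
  then have IJ: "I = - J" using Fh has_contour_integral_unique add_eq_0_iff2 by blast
  have R2: "R\<^sup>2 > 1" using R by (simp add: one_less_power)
  have "norm J \<le> (2 / (R\<^sup>2 - 1)) * R * (pi - 0)"
  proof (rule has_contour_integral_bound_part_circlepath[OF J])
    fix z assume "z \<in> path_image (part_circlepath 0 R 0 pi)"
    then obtain t where t: "0 \<le> t" "t \<le> pi" "z = R * cis t"
      by (auto simp: path_image_part_circlepath' cis_conv_exp closed_segment_eq_real_ivl)
    have nz: "norm z = R" using R by (simp add: t norm_mult)
    have Im: "Im z \<ge> 0" using t R by (auto intro!: mult_nonneg_nonneg sin_ge_zero)
    have ne: "z \<noteq> \<i>" using nz R by auto
    have "F z = (f z - f \<i>) / (z\<^sup>2 + 1)"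
      using ne by (simp add: F_def q_def power2_eq_square field_simps)
    moreover have "norm (f z - f \<i>) \<le> 2"
    proof -
      have "norm (f z) \<le> 1" using Im a by (simp add: f_def mult_nonneg_nonneg)
      moreover have "norm (f \<i>) \<le> 1" using a by (simp add: fi)
      ultimately show ?thesis using norm_triangle_ineq4[of "f z" "f \<i>"] by linarith
    qed
    moreover have "norm (z\<^sup>2 + 1) \<ge> R\<^sup>2 - 1"
      using norm_diff_ineq[of "z\<^sup>2" 1] nz by (simp add: norm_power)
    ultimately show "norm (F z) \<le> 2 / (R\<^sup>2 - 1)"
      using R2 by (simp add: norm_divide frac_le)
  qed (use R R2 in auto)
  then have nI: "norm I \<le> 2 * pi * R / (R\<^sup>2 - 1)" by (simp add: IJ field_simps)
  have Fr: "F (of_real x) = (iexp (a * x) - of_real (exp (- a))) / of_real (1 + x\<^sup>2)" for x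
  proof -
    have "complex_of_real x \<noteq> \<i>" "complex_of_real x \<noteq> - \<i>" by (auto simp: complex_eq_iff)
    then have "F (of_real x) = (f x - f \<i>) / ((x - \<i>) * (x + \<i>))"
      by (simp add: F_def q_def)
    also have "(x - \<i>) * (x + \<i>) = complex_of_real (1 + x\<^sup>2)" by (simp add: power2_eq_square algebra_simps)
    finally show ?thesis unfolding fi by (simp add: f_def mult.assoc)
  qed
  have "((\<lambda>x. (iexp (a * x) - of_real (exp (- a))) / of_real (1 + x\<^sup>2)) has_integral I) {-R..R}"
    using I R has_contour_integral_linepath_Reals_iff[of "of_real (-R)" "of_real R" F I] by (simp add: Fr)
  moreover have "set_integrable lborel {-R..R} (\<lambda>x. (iexp (a * x) - of_real (exp (- a))) / of_real (1 + x\<^sup>2))"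
  proof (rule borel_integrable_atLeastAtMost')
    have "1 + x\<^sup>2 \<noteq> 0" for x :: real using zero_le_power2[of x] by linarith
    then have "complex_of_real (1 + x\<^sup>2) \<noteq> 0" for x unfolding of_real_eq_0_iff .
    then show "continuous_on {- R..R} (\<lambda>x. (iexp (a * x) - of_real (exp (- a))) / of_real (1 + x\<^sup>2))"
      by (intro continuous_intros) auto
  qed
  ultimately have "(\<integral>x\<in>{-R..R}. (iexp (a * x) - of_real (exp (- a))) / of_real (1 + x\<^sup>2) \<partial>lborel) = I"
    using set_borel_integral_eq_integral(2) by (metis integral_unique)
  then show ?thesis using nI by simp
qed

text \<open>The truncated integrals with \<open>exp (- a)\<close> subtracted tend to zero, so the Fourier integral at \<open>a \<ge> 0\<close> is
  \<open>exp (- a)\<close> times the integral of the Cauchy kernel. The reflection \<open>t \<mapsto> - t\<close> settles negative arguments.\<close>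

lemma fourier_cauchy:
  shows "integrable lborel (\<lambda>t. iexp (x * t) / of_real (1 + t\<^sup>2))" (is "?int x")
    and "(\<integral>t. iexp (x * t) / of_real (1 + t\<^sup>2) \<partial>lborel) = of_real (pi * exp (- \<bar>x\<bar>))" (is "?eq x")
proof -
  have int: "?int x" for x
    by (rule Bochner_Integration.integrable_bound[OF integrable_inverse_1_plus_square(1)])
       (auto simp: norm_divide simp del: of_real_add)
  then show "?int x" .
  have pos: "?eq a" if a: "a \<ge> 0" for a
  proof -
    let ?g = "\<lambda>x. (iexp (a * x) - of_real (exp (- a))) / of_real (1 + x\<^sup>2)"
    have i1: "integrable lborel (\<lambda>x. of_real (exp (- a)) * complex_of_real (1 / (1 + x\<^sup>2)))"
      by (intro integrable_mult_right integrable_of_real integrable_inverse_1_plus_square)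
    have g: "?g = (\<lambda>x. iexp (a * x) / of_real (1 + x\<^sup>2) - of_real (exp (- a)) * complex_of_real (1 / (1 + x\<^sup>2)))"
      by (simp add: fun_eq_iff diff_divide_distrib)
    have gi: "integrable lborel ?g" unfolding g by (rule Bochner_Integration.integrable_diff[OF int i1])
    have "(\<lambda>n. \<integral>x\<in>{-real n..real n}. ?g x \<partial>lborel) \<longlonglongrightarrow> (\<integral>x. ?g x \<partial>lborel)"
      unfolding set_lebesgue_integral_def
    proof (rule integral_dominated_convergence)
      show "integrable lborel (\<lambda>x. norm (?g x))" using gi by (rule integrable_norm)
      show "AE x in lborel. (\<lambda>n. indicat_real {- real n..real n} x *\<^sub>R ?g x) \<longlonglongrightarrow> ?g x"
      proof (rule AE_I2)
        fix x :: real
        obtain N where N: "\<bar>x\<bar> \<le> real N" using real_arch_simple by blast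
        have "eventually (\<lambda>n. indicat_real {- real n..real n} x *\<^sub>R ?g x = ?g x) sequentially"
          using eventually_ge_at_top[of N] by eventually_elim (use N in \<open>auto simp: indicator_def\<close>)
        then show "(\<lambda>n. indicat_real {- real n..real n} x *\<^sub>R ?g x) \<longlonglongrightarrow> ?g x"
          by (rule tendsto_eventually)
      qed
    qed (use gi in \<open>auto simp: indicator_def\<close>)
    moreover have "(\<lambda>n. \<integral>x\<in>{-real n..real n}. ?g x \<partial>lborel) \<longlonglongrightarrow> 0"
    proof (rule Lim_null_comparison)
      show "eventually (\<lambda>n. norm (\<integral>x\<in>{-real n..real n}. ?g x \<partial>lborel) \<le> 2 * pi * real n / ((real n)\<^sup>2 - 1)) sequentially"
        using eventually_gt_at_top[of 1] by eventually_elim (rule norm_truncated_fourier_cauchy_le, use a in auto)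
      show "(\<lambda>n. 2 * pi * real n / ((real n)\<^sup>2 - 1)) \<longlonglongrightarrow> 0" by real_asymp
    qed
    ultimately have "(\<integral>x. ?g x \<partial>lborel) = 0" by (rule LIMSEQ_unique)
    then have "(\<integral>t. iexp (a * t) / of_real (1 + t\<^sup>2) \<partial>lborel) = (\<integral>x. of_real (exp (- a)) * complex_of_real (1 / (1 + x\<^sup>2)) \<partial>lborel)"
      unfolding g Bochner_Integration.integral_diff[OF int i1] by simp
    also have "\<dots> = of_real (exp (- a)) * complex_of_real pi"
      by (simp only: integral_mult_right_zero integral_complex_of_real integrable_inverse_1_plus_square(2))
    finally show ?thesis using a by (simp add: mult.commute)
  qed
  show "?eq x"
  proof (cases "x \<ge> 0")
    case False
    have "(\<integral>t. iexp (x * t) / of_real (1 + t\<^sup>2) \<partial>lborel) = (\<integral>t. iexp ((- x) * t) / of_real (1 + t\<^sup>2) \<partial>lborel)"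
      by (subst lborel_integral_real_affine[where c="-1" and t=0]) auto
    then show ?thesis using pos[of "- x"] False by simp
  qed (rule pos)
qed

lemma integral_standard_gaussian:
  "integrable lborel (\<lambda>y :: real ^ 'n. exp (- pi * (norm y)\<^sup>2))"
  "(\<integral>y. exp (- pi * (norm y)\<^sup>2) \<partial>(lborel :: (real ^ 'n) measure)) = 1"
proof -
  have eq: "exp (- pi * (norm y)\<^sup>2) = (\<Prod>j\<in>UNIV. exp (- pi * (y $ j)\<^sup>2))" for y :: "real ^ 'n"
    by (simp add: norm_vec_square exp_sum[symmetric] sum_distrib_left sum_negf)
  have int: "integrable lborel (\<lambda>t::real. exp (- pi * t\<^sup>2))"
    using integrable_Re[OF gaussian_fourier(1)[of 1 0]] by simp
  have "complex_of_real (\<integral>t. exp (- pi * t\<^sup>2) \<partial>lborel) = complex_of_real 1"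
    using gaussian_fourier(2)[of 1 0] by simp
  then have val: "(\<integral>t. exp (- pi * t\<^sup>2) \<partial>lborel) = 1" unfolding of_real_eq_iff .
  show "integrable lborel (\<lambda>y :: real ^ 'n. exp (- pi * (norm y)\<^sup>2))"
    unfolding eq by (rule integrable_prod_vec) (rule int)
  show "(\<integral>y. exp (- pi * (norm y)\<^sup>2) \<partial>(lborel :: (real ^ 'n) measure)) = 1"
    unfolding eq by (subst integral_prod_vec[OF int]) (simp only: val prod.neutral_const)
qed

section \<open>Sections of the exponential and Gaussian regularisation\<close>

lemma lborel_pair_integrable_mult_bounded:
  fixes A :: "'a::euclidean_space \<Rightarrow> real" and G :: "'b::euclidean_space \<Rightarrow> real" and u :: "'a \<Rightarrow> 'b \<Rightarrow> complex"
  assumes A: "integrable lborel A" and G: "integrable lborel G"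
    and [measurable]: "(\<lambda>(x, y). u x y) \<in> borel_measurable (borel \<Otimes>\<^sub>M borel)" and u: "\<And>x y. norm (u x y) = 1"
  shows "integrable (lborel \<Otimes>\<^sub>M lborel) (\<lambda>(x, y). of_real (A x) * u x y * of_real (G y))"
proof (rule lborel_pair.Fubini_integrable)
  have [measurable]: "A \<in> borel_measurable borel" "G \<in> borel_measurable borel"
    using A G borel_measurable_integrable by force+
  show "(\<lambda>(x, y). of_real (A x) * u x y * of_real (G y)) \<in> borel_measurable (lborel \<Otimes>\<^sub>M lborel)"
    by measurable
  show "integrable lborel (\<lambda>x. \<integral>y. norm (case (x, y) of (x, y) \<Rightarrow> of_real (A x) * u x y * of_real (G y)) \<partial>lborel)"
    using integrable_norm[OF A] by (simp add: norm_mult u)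
  have "integrable lborel (\<lambda>y. of_real (A x) * u x y * of_real (G y))" for x
    by (rule Bochner_Integration.integrable_bound[where f="\<lambda>y. A x * G y"])
       (use G in \<open>auto simp: norm_mult u abs_mult\<close>)
  then show "AE x in lborel. integrable lborel (\<lambda>y. case (x, y) of (x, y) \<Rightarrow> of_real (A x) * u x y * of_real (G y))"
    by simp
qed

lemma integrable_prod_cauchy:
  "integrable (lborel :: (real ^ 'n) measure) (\<lambda>\<xi>. \<Prod>j\<in>UNIV. 1 / (1 + (\<xi> $ j)\<^sup>2))"
  by (rule integrable_prod_vec) (rule integrable_inverse_1_plus_square)

lemma integrable_gaussian_vec:
  fixes \<delta> :: real assumes "\<delta> > 0"
  shows "integrable (lborel :: (real ^ 'k) measure) (\<lambda>z. exp (- pi * \<delta>\<^sup>2 * (norm z)\<^sup>2))"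
proof -
  have eq: "exp (- pi * \<delta>\<^sup>2 * (norm z)\<^sup>2) = (\<Prod>i\<in>UNIV. exp (- pi * \<delta>\<^sup>2 * (z $ i)\<^sup>2))" for z :: "real ^ 'k"
    by (simp add: norm_vec_square exp_sum[symmetric] sum_distrib_left sum_negf)
  have "integrable lborel (\<lambda>t::real. exp (- pi * \<delta>\<^sup>2 * t\<^sup>2))"
    using integrable_Re[OF gaussian_fourier(1)[OF assms, of 0]] by simp
  then show ?thesis unfolding eq by (rule integrable_prod_vec)
qed

text \<open>Plancherel's identity for the pair of subspaces \<open>range f\<close> and its complement, with a Gaussian
  in place of the delta measure on \<open>range f\<close>. Up to constant factors, both sides are iterated integrals of
  \<open>exp (- \<pi> \<delta>\<^sup>2 \<parallel>z\<parallel>\<^sup>2) * exp (\<i> (f z \<bullet> \<xi>)) * \<Prod>\<^sub>j 1 / (1 + \<xi>\<^sub>j\<^sup>2)\<close>: the integral in \<open>\<xi>\<close> is a product of Fourier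
  integrals of Cauchy kernels, and the one in \<open>z\<close> is the Fourier transform of a Gaussian at
  \<open>adjoint f \<xi>\<close>.\<close>

lemma gaussian_section_fourier:
  fixes f :: "real ^ 'k \<Rightarrow> real ^ 'n" and \<delta> :: real
  assumes lin: "linear f" and \<delta>: "\<delta> > 0"
  shows "pi ^ CARD('n) * (\<integral>z. exp (- pi * \<delta>\<^sup>2 * (norm z)\<^sup>2) * exp (- (\<Sum>j\<in>UNIV. \<bar>f z $ j\<bar>)) \<partial>lborel)
    = (\<integral>\<xi>. exp (- (norm (adjoint f \<xi>))\<^sup>2 / (4 * pi * \<delta>\<^sup>2)) * (\<Prod>j\<in>UNIV. 1 / (1 + (\<xi> $ j)\<^sup>2)) \<partial>lborel) / \<delta> ^ CARD('k)"
proof -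
  let ?A = "\<lambda>z :: real ^ 'k. exp (- pi * \<delta>\<^sup>2 * (norm z)\<^sup>2)"
  let ?G = "\<lambda>\<xi> :: real ^ 'n. \<Prod>j\<in>UNIV. 1 / (1 + (\<xi> $ j)\<^sup>2)"
  let ?H = "\<lambda>z \<xi>. of_real (?A z) * iexp (f z \<bullet> \<xi>) * of_real (?G \<xi>)"
  have [measurable]: "f \<in> borel_measurable borel"
    using lin by (intro borel_measurable_continuous_onI linear_continuous_on) (simp add: linear_conv_bounded_linear)
  have "integrable (lborel \<Otimes>\<^sub>M lborel) (\<lambda>(z, \<xi>). ?H z \<xi>)"
    by (rule lborel_pair_integrable_mult_bounded[OF integrable_gaussian_vec[OF \<delta>] integrable_prod_cauchy]) auto
  then have "(\<integral>\<xi>. (\<integral>z. ?H z \<xi> \<partial>lborel) \<partial>lborel) = (\<integral>z. (\<integral>\<xi>. ?H z \<xi> \<partial>lborel) \<partial>lborel)"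
    by (rule lborel_pair.Fubini_integral)
  moreover have "(\<integral>\<xi>. ?H z \<xi> \<partial>lborel) = of_real (pi ^ CARD('n) * (?A z * exp (- (\<Sum>j\<in>UNIV. \<bar>f z $ j\<bar>))))" for z
  proof -
    have eq: "iexp (f z \<bullet> \<xi>) * of_real (?G \<xi>) = (\<Prod>j\<in>UNIV. iexp (f z $ j * \<xi> $ j) / of_real (1 + (\<xi> $ j)\<^sup>2))" for \<xi>
    proof -
      have "iexp (f z \<bullet> \<xi>) = (\<Prod>j\<in>UNIV. iexp (f z $ j * \<xi> $ j))"
        by (simp add: inner_vec_def sum_distrib_left exp_sum[symmetric])
      then show ?thesis by (simp add: prod_dividef del: of_real_add of_real_mult)
    qed
    have "(\<integral>\<xi>. ?H z \<xi> \<partial>lborel) = of_real (?A z) * (\<integral>\<xi>. (\<Prod>j\<in>UNIV. iexp (f z $ j * \<xi> $ j) / of_real (1 + (\<xi> $ j)\<^sup>2)) \<partial>lborel)"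
      unfolding mult.assoc eq integral_mult_right_zero ..
    also have "(\<integral>\<xi>. (\<Prod>j\<in>UNIV. iexp (f z $ j * \<xi> $ j) / of_real (1 + (\<xi> $ j)\<^sup>2)) \<partial>(lborel :: (real ^ 'n) measure))
       = (\<Prod>j\<in>UNIV. of_real (pi * exp (- \<bar>f z $ j\<bar>)))"
      unfolding fourier_cauchy(2)[symmetric] by (rule integral_prod_vec) (rule fourier_cauchy(1))
    also have "\<dots> = of_real (pi ^ CARD('n) * exp (- (\<Sum>j\<in>UNIV. \<bar>f z $ j\<bar>)))"
      by (simp add: prod.distrib exp_sum sum_negf[symmetric])
    finally show ?thesis by simp
  qed
  moreover have "(\<integral>z. ?H z \<xi> \<partial>lborel) = of_real (exp (- (norm (adjoint f \<xi>))\<^sup>2 / (4 * pi * \<delta>\<^sup>2)) * ?G \<xi> / \<delta> ^ CARD('k))" for \<xi>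
  proof -
    let ?w = "adjoint f \<xi>"
    have eq: "of_real (?A z) * iexp (f z \<bullet> \<xi>) = (\<Prod>i\<in>UNIV. of_real (exp (- pi * \<delta>\<^sup>2 * (z $ i)\<^sup>2)) * iexp (z $ i * ?w $ i))" for z
    proof -
      have "f z \<bullet> \<xi> = (\<Sum>i\<in>UNIV. z $ i * ?w $ i)" using adjoint_works[OF lin, of z \<xi>] by (simp add: inner_vec_def)
      then have "iexp (f z \<bullet> \<xi>) = (\<Prod>i\<in>UNIV. iexp (z $ i * ?w $ i))"
        by (simp add: sum_distrib_left exp_sum[symmetric])
      moreover have "?A z = (\<Prod>i\<in>UNIV. exp (- pi * \<delta>\<^sup>2 * (z $ i)\<^sup>2))"
        by (simp add: norm_vec_square exp_sum[symmetric] sum_distrib_left sum_negf)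
      ultimately show ?thesis by (simp only: of_real_prod prod.distrib)
    qed
    have "(\<integral>z. ?H z \<xi> \<partial>lborel) = (\<integral>z. (\<Prod>i\<in>UNIV. of_real (exp (- pi * \<delta>\<^sup>2 * (z $ i)\<^sup>2)) * iexp (z $ i * ?w $ i)) \<partial>lborel) * of_real (?G \<xi>)"
      unfolding eq integral_mult_left_zero ..
    also have "(\<integral>z. (\<Prod>i\<in>UNIV. of_real (exp (- pi * \<delta>\<^sup>2 * (z $ i)\<^sup>2)) * iexp (z $ i * ?w $ i)) \<partial>(lborel :: (real ^ 'k) measure))
       = (\<Prod>i\<in>UNIV. of_real (exp (- (?w $ i)\<^sup>2 / (4 * pi * \<delta>\<^sup>2)) / \<delta>))"
      unfolding gaussian_fourier(2)[OF \<delta>, symmetric] by (rule integral_prod_vec) (rule gaussian_fourier(1)[OF \<delta>])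
    also have "\<dots> = of_real (\<Prod>i\<in>UNIV. exp (- (?w $ i)\<^sup>2 / (4 * pi * \<delta>\<^sup>2)) / \<delta>)" by simp
    also have "(\<Prod>i\<in>UNIV. exp (- (?w $ i)\<^sup>2 / (4 * pi * \<delta>\<^sup>2)) / \<delta>) = exp (- (norm ?w)\<^sup>2 / (4 * pi * \<delta>\<^sup>2)) / \<delta> ^ CARD('k)"
      by (simp add: prod_dividef exp_sum[symmetric] norm_vec_square sum_divide_distrib sum_negf)
    finally show ?thesis by simp
  qed
  ultimately have "complex_of_real (\<integral>\<xi>. exp (- (norm (adjoint f \<xi>))\<^sup>2 / (4 * pi * \<delta>\<^sup>2)) * ?G \<xi> / \<delta> ^ CARD('k) \<partial>lborel)
     = complex_of_real (\<integral>z. pi ^ CARD('n) * (?A z * exp (- (\<Sum>j\<in>UNIV. \<bar>f z $ j\<bar>))) \<partial>lborel)"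
    by (simp only: integral_complex_of_real)
  then show ?thesis unfolding of_real_eq_iff by simp
qed

section \<open>Monotone transport on the line\<close>

text \<open>The distribution function of \<open>f\<close>. Having the open interval as its exact range makes two such
  functions of equal total mass composable with an inverse.\<close>

lemma ex_antiderivative_bij:
  fixes f :: "real \<Rightarrow> real"
  assumes cont: "continuous_on UNIV f" and pos: "\<And>t. f t > 0" and int: "integrable lborel f"
  obtains F where "\<And>t. (F has_real_derivative f t) (at t)" "strict_mono F"
    "F ` UNIV = {0<..<integral\<^sup>L lborel f}"
proof -
  define I where "I = integral\<^sup>L lborel f"
  have "\<And>x. isCont f x" using cont by (simp add: continuous_on_eq_continuous_at)
  then obtain A where A: "\<And>x. (A has_real_derivative f x) (at x)"
    using einterval_antiderivative[of "-\<infinity>" "\<infinity>" f]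
    by (auto simp: has_real_derivative_iff_has_vector_derivative)
  have seti: "set_integrable lborel S f" if "S \<in> sets borel" for S
    using that int unfolding set_integrable_def by (intro integrable_mult_indicator) auto
  define F where "F t = (\<integral>x\<in>{..0}. f x \<partial>lborel) + (A t - A 0)" for t
  have dF: "(F has_real_derivative f t) (at t)" for t
    unfolding F_def by (auto intro!: derivative_eq_intros A)
  have mono: "strict_mono F"
    by (rule strict_monoI) (rule DERIV_pos_imp_increasing; use dF pos in blast)
  have ftc: "(\<integral>x\<in>{a..b}. f x \<partial>lborel) = A b - A a" if "a \<le> b" for a b
  proof -
    have "(\<integral>x. f x * indicator {a..b} x \<partial>lborel) = A b - A a"
      by (rule integral_FTC_Icc_real[OF that A]) (use cont in \<open>simp add: continuous_on_eq_continuous_at\<close>)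
    then show ?thesis by (simp add: set_lebesgue_integral_def mult.commute)
  qed
  have top: "(F \<longlongrightarrow> I) at_top"
  proof -
    have "((\<lambda>b. \<integral>x\<in>{0..b}. f x \<partial>lborel) \<longlongrightarrow> (\<integral>x\<in>{0..}. f x \<partial>lborel)) at_top"
      by (rule tendsto_set_lebesgue_integral_at_top) (auto intro!: seti)
    then have "((\<lambda>b. (\<integral>x\<in>{..0}. f x \<partial>lborel) + (\<integral>x\<in>{0..b}. f x \<partial>lborel)) \<longlongrightarrow> (\<integral>x\<in>{..0}. f x \<partial>lborel) + (\<integral>x\<in>{0..}. f x \<partial>lborel)) at_top"
      by (intro tendsto_intros)
    moreover have "(\<integral>x\<in>{..0}. f x \<partial>lborel) + (\<integral>x\<in>{0..}. f x \<partial>lborel) = I"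
    proof -
      have "(\<integral>x\<in>{..0} \<union> {0..}. f x \<partial>lborel) = (\<integral>x\<in>{..0}. f x \<partial>lborel) + (\<integral>x\<in>{0..}. f x \<partial>lborel)"
      proof (rule set_integral_Un_AE)
        have "AE x in lborel. x \<noteq> (0::real)" by (rule AE_lborel_singleton)
        then show "AE x in lborel. \<not> (x \<in> {..0} \<and> x \<in> {0::real..})" by eventually_elim auto
      qed (auto intro!: seti)
      moreover have "{..0} \<union> {0::real..} = UNIV" by auto
      ultimately show ?thesis by (simp add: I_def set_lebesgue_integral_def)
    qed
    moreover have "eventually (\<lambda>b. (\<integral>x\<in>{..0}. f x \<partial>lborel) + (\<integral>x\<in>{0..b}. f x \<partial>lborel) = F b) at_top"
      using eventually_ge_at_top[of 0] by eventually_elim (simp add: F_def ftc)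
    ultimately show ?thesis by (auto elim: Lim_transform_eventually)
  qed
  have bot: "(F \<longlongrightarrow> 0) at_bot"
  proof -
    have "((\<lambda>a. \<integral>x\<in>{a..0}. f x \<partial>lborel) \<longlongrightarrow> (\<integral>x\<in>{..0}. f x \<partial>lborel)) at_bot"
      by (rule tendsto_set_lebesgue_integral_at_bot) (auto intro!: seti)
    then have "((\<lambda>a. (\<integral>x\<in>{..0}. f x \<partial>lborel) - (\<integral>x\<in>{a..0}. f x \<partial>lborel)) \<longlongrightarrow> (\<integral>x\<in>{..0}. f x \<partial>lborel) - (\<integral>x\<in>{..0}. f x \<partial>lborel)) at_bot"
      by (intro tendsto_intros)
    moreover have "eventually (\<lambda>a. (\<integral>x\<in>{..0}. f x \<partial>lborel) - (\<integral>x\<in>{a..0}. f x \<partial>lborel) = F a) at_bot"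
      using eventually_le_at_bot[of 0] by eventually_elim (simp add: F_def ftc)
    ultimately show ?thesis by (auto elim: Lim_transform_eventually)
  qed
  have "F ` UNIV = {0<..<I}"
  proof (intro equalityI subsetI)
    fix y assume "y \<in> F ` UNIV"
    then obtain t where t: "y = F t" by auto
    have "F (t + 1) \<le> I"
    proof (rule tendsto_lowerbound[OF top])
      show "eventually (\<lambda>x. F (t + 1) \<le> F x) at_top"
        using eventually_ge_at_top[of "t + 1"] by eventually_elim (simp add: strict_mono_less_eq[OF mono])
    qed simp
    moreover have "0 \<le> F (t - 1)"
    proof (rule tendsto_upperbound[OF bot])
      show "eventually (\<lambda>x. F x \<le> F (t - 1)) at_bot"
        using eventually_le_at_bot[of "t - 1"] by eventually_elim (simp add: strict_mono_less_eq[OF mono])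
    qed simp
    moreover have "F (t - 1) < F t" "F t < F (t + 1)" using mono by (simp_all add: strict_mono_less)
    ultimately show "y \<in> {0<..<I}" by (simp add: t)
  next
    fix y assume y: "y \<in> {0<..<I}"
    have "eventually (\<lambda>t. F t > y) at_top" using order_tendstoD(1)[OF top] y by simp
    then obtain b where b: "F b > y" by (auto dest: eventually_happens)
    have "eventually (\<lambda>t. F t < y) at_bot" using order_tendstoD(2)[OF bot] y by simp
    then obtain a where a: "F a < y" by (auto dest: eventually_happens)
    have "a \<le> b" using a b strict_mono_less[OF mono, of a b] by linarith
    then obtain x where "F x = y"
      using IVT[of F a y b] a b dF by (meson DERIV_isCont less_imp_le)
    then show "y \<in> F ` UNIV" by auto
  qed
  with dF mono show thesis using that unfolding I_def by blast
qed

text \<open>The increasing rearrangement \<open>G\<inverse> \<circ> F\<close> of the two distribution functions.\<close>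

lemma ex_transport_map:
  fixes f g :: "real \<Rightarrow> real"
  assumes f: "continuous_on UNIV f" "\<And>t. f t > 0" "integrable lborel f"
    and g: "continuous_on UNIV g" "\<And>t. g t > 0" "integrable lborel g"
    and eq: "integral\<^sup>L lborel f = integral\<^sup>L lborel g"
  obtains S where "\<And>t. (S has_real_derivative f t / g (S t)) (at t)"
proof -
  obtain F where F: "\<And>t. (F has_real_derivative f t) (at t)" "strict_mono F" "F ` UNIV = {0<..<integral\<^sup>L lborel f}"
    using ex_antiderivative_bij[OF f] by blast
  obtain G where G: "\<And>t. (G has_real_derivative g t) (at t)" "strict_mono G" "G ` UNIV = {0<..<integral\<^sup>L lborel g}"
    using ex_antiderivative_bij[OF g] by blast
  have injG: "inj G" using G(2) by (rule strict_mono_imp_inj_on)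
  define S where "S t = inv G (F t)" for t
  have GS: "G (S t) = F t" for t
  proof -
    have "F t \<in> range G" using F(3) G(3) eq rangeI[of F t] by simp
    then show ?thesis by (simp add: S_def f_inv_into_f)
  qed
  have "(S has_real_derivative f t / g (S t)) (at t)" for t
  proof -
    have "(inv G has_derivative (\<lambda>x. x / g (S t))) (at (G (S t)))"
    proof (rule has_derivative_inverse_strong[where S=UNIV and f=G and x="S t" and f'="(*) (g (S t))"])
      show "(G has_derivative (*) (g (S t))) (at (S t))"
        using G(1) by (simp add: has_field_derivative_def)
      show "continuous_on UNIV G" using G(1) by (meson DERIV_isCont continuous_at_imp_continuous_on)
      show "(*) (g (S t)) \<circ> (\<lambda>x. x / g (S t)) = id" using g(2)[of "S t"] by (auto simp: fun_eq_iff)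
    qed (use injG in auto)
    then have "(inv G has_real_derivative 1 / g (S t)) (at (F t))"
    proof -
      have "(\<lambda>x. x / g (S t)) = (*) (1 / g (S t))" by (simp add: fun_eq_iff)
      then show ?thesis
        using \<open>(inv G has_derivative _) _\<close> by (simp add: has_field_derivative_def GS)
    qed
    from DERIV_chain2[OF this F(1)] show ?thesis by (simp add: S_def[abs_def])
  qed
  then show thesis by (rule that)
qed

text \<open>The map \<open>S\<close> carries \<open>f\<close>, rescaled to mass \<open>p\<close>, to the Gaussian \<open>exp (- \<pi> y\<^sup>2 / p\<^sup>2)\<close>, which has mass \<open>p\<close>. Raised to the
  power \<open>p\<^sup>2\<close>, that Gaussian turns into \<open>exp (- \<pi> y\<^sup>2)\<close>, so that the exponents of several such maps
  add up to a Euclidean norm.\<close>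

lemma ex_transport_to_gaussian:
  fixes f :: "real \<Rightarrow> real" and p :: real
  assumes f: "continuous_on UNIV f" "\<And>t. f t > 0" "integrable lborel f" and p: "p > 0"
  obtains S s where "\<And>t. (S has_real_derivative s t) (at t)" "\<And>t. s t > 0"
    "\<And>t. f t powr p\<^sup>2 = (integral\<^sup>L lborel f / p) powr p\<^sup>2 * (exp (- pi * (S t)\<^sup>2) * s t powr p\<^sup>2)"
proof -
  define I where "I = integral\<^sup>L lborel f"
  have I: "I > 0"
  proof -
    obtain F where "\<And>t. (F has_real_derivative f t) (at t)" "strict_mono F" "F ` UNIV = {0<..<I}"
      using ex_antiderivative_bij[OF f] unfolding I_def by blast
    then have "F 0 \<in> {0<..<I}" by blast
    then show ?thesis by simp
  qed
  let ?f = "\<lambda>t. (p / I) * f t" and ?g = "\<lambda>y. exp (- pi * (1 / p)\<^sup>2 * y\<^sup>2)"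
  have gi: "integrable lborel ?g"
    using integrable_Re[OF gaussian_fourier(1)[of "1 / p" 0]] p by simp
  have "complex_of_real (\<integral>t. ?g t \<partial>lborel) = complex_of_real p"
    using gaussian_fourier(2)[of "1 / p" 0] p by simp
  then have gI: "(\<integral>t. ?g t \<partial>lborel) = p" unfolding of_real_eq_iff .
  have fI: "(\<integral>t. ?f t \<partial>lborel) = p" using I by (simp add: I_def[symmetric])
  obtain S where S: "\<And>t. (S has_real_derivative ?f t / ?g (S t)) (at t)"
  proof (rule ex_transport_map[of ?f ?g])
    show "continuous_on UNIV ?f" by (intro continuous_intros f(1))
    show "continuous_on UNIV ?g" by (intro continuous_intros)
    show "integrable lborel ?f" using f(3) by simp
    show "integral\<^sup>L lborel ?f = integral\<^sup>L lborel ?g" unfolding fI gI ..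
  qed (use I p f(2) gi in auto)
  define s where "s t = ?f t / ?g (S t)" for t
  have "f t powr p\<^sup>2 = (I / p) powr p\<^sup>2 * (exp (- pi * (S t)\<^sup>2) * s t powr p\<^sup>2)" for t
  proof -
    have "f t = (I / p) * (?g (S t) * s t)" using I p by (simp add: s_def)
    moreover have "?g (S t) powr p\<^sup>2 = exp (- pi * (S t)\<^sup>2)"
      using p by (simp add: exp_powr_real power_divide)
    moreover have "s t > 0" using I p f(2) by (simp add: s_def)
    moreover have "((I / p) * (?g (S t) * s t)) powr p\<^sup>2 = (I / p) powr p\<^sup>2 * (?g (S t) powr p\<^sup>2 * s t powr p\<^sup>2)"
      using I p \<open>s t > 0\<close> by (simp only: powr_mult)
    ultimately show ?thesis by metis
  qed
  moreover have "s t > 0" for t using I p f(2) by (simp add: s_def)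
  moreover have "(S has_real_derivative s t) (at t)" for t using S[of t] by (simp only: s_def)
  ultimately show thesis unfolding I_def by (intro that)
qed

section \<open>Determinant of a compressed diagonal map\<close>

text \<open>A maximiser \<open>v\<close> of the quadratic form on the unit sphere of the subspace is an eigenvector: with
  \<open>l\<close> the maximum, the form \<open>l * (y \<bullet> y) - T y \<bullet> y\<close> is nonnegative and vanishes at \<open>v\<close>, hence so does
  its derivative there, which is the residual \<open>l v - T v\<close>.\<close>

lemma ex_eigenvector_in_subspace:
  fixes T :: "'a::euclidean_space \<Rightarrow> 'a"
  assumes lin: "linear T" and sa: "\<And>x y. T x \<bullet> y = x \<bullet> T y"
    and V: "subspace V" "\<And>x. x \<in> V \<Longrightarrow> T x \<in> V" "V \<noteq> {0}"
  obtains v l where "v \<in> V" "norm v = 1" "T v = l *\<^sub>R v"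
proof -
  obtain u where u: "u \<in> V" "u \<noteq> 0" using V(3) subspace_0[OF V(1)] by blast
  have "compact (sphere 0 1 \<inter> V)"
    by (intro compact_Int_closed closed_subspace V(1)) simp
  moreover have "sphere 0 1 \<inter> V \<noteq> {}"
  proof -
    have "(1 / norm u) *\<^sub>R u \<in> sphere 0 1 \<inter> V" using u V(1) by (simp add: subspace_scale)
    then show ?thesis by blast
  qed
  moreover have "continuous_on (sphere 0 1 \<inter> V) (\<lambda>x. T x \<bullet> x)"
    using lin by (intro continuous_intros linear_continuous_on) (simp add: linear_conv_bounded_linear)
  ultimately obtain v where v': "v \<in> sphere 0 1 \<inter> V" and max': "\<forall>y\<in>sphere 0 1 \<inter> V. T y \<bullet> y \<le> T v \<bullet> v"
    using continuous_attains_sup[of "sphere 0 1 \<inter> V" "\<lambda>x. T x \<bullet> x"] by blast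
  have v: "v \<in> V" "norm v = 1" using v' by auto
  have max: "T y \<bullet> y \<le> T v \<bullet> v" if "y \<in> V" "norm y = 1" for y using max' that by auto
  define l where "l = T v \<bullet> v"
  have nonneg: "l * (y \<bullet> y) - T y \<bullet> y \<ge> 0" if "y \<in> V" for y
  proof (cases "y = 0")
    case False
    define c where "c = 1 / norm y"
    have "T (c *\<^sub>R y) \<bullet> (c *\<^sub>R y) \<le> l"
      unfolding l_def using False that V(1) by (intro max) (auto simp: subspace_scale c_def)
    then have "c\<^sup>2 * (T y \<bullet> y) \<le> l" by (simp add: linear_scale[OF lin] power2_eq_square mult.assoc)
    then have "(norm y)\<^sup>2 * (c\<^sup>2 * (T y \<bullet> y)) \<le> (norm y)\<^sup>2 * l" by (intro mult_left_mono) auto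
    then show ?thesis using False by (simp add: c_def power_divide power2_norm_eq_inner mult.commute)
  qed (simp add: linear_0[OF lin])
  define w where "w = l *\<^sub>R v - T v"
  have w: "w \<in> V" unfolding w_def using v V by (intro subspace_diff subspace_scale) auto
  define c where "c = l * (w \<bullet> w) - T w \<bullet> w"
  have c: "c \<ge> 0" unfolding c_def by (rule nonneg[OF w])
  have "w = 0"
  proof (rule ccontr)
    assume "w \<noteq> 0"
    then have ww: "w \<bullet> w > 0" by simp
    define s where "s = (w \<bullet> w) / (c + 1)"
    have s: "s > 0" using ww c by (simp add: s_def)
    \<comment> \<open>Expand the form at \<open>v - s w\<close>: the linear term \<open>- 2 s (w \<bullet> w)\<close> outweighs the quadratic one for this \<open>s\<close>.\<close>
    have "0 \<le> l * ((v - s *\<^sub>R w) \<bullet> (v - s *\<^sub>R w)) - T (v - s *\<^sub>R w) \<bullet> (v - s *\<^sub>R w)"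
      by (intro nonneg subspace_diff subspace_scale V(1) v(1) w)
    also have "\<dots> = (l * (v \<bullet> v) - T v \<bullet> v) - 2 * s * (l * (v \<bullet> w) - T v \<bullet> w) + s\<^sup>2 * c"
    proof -
      have c1: "T w \<bullet> v = T v \<bullet> w" and c2: "w \<bullet> v = v \<bullet> w"
        using sa[of w v] by (simp_all add: inner_commute)
      show ?thesis
        by (simp add: linear_diff[OF lin] linear_scale[OF lin] inner_diff_left inner_diff_right c1 c2)
           (simp add: c_def power2_eq_square algebra_simps)
    qed
    also have "l * (v \<bullet> v) - T v \<bullet> v = 0" using v(2) by (simp add: l_def dot_square_norm)
    also have "l * (v \<bullet> w) - T v \<bullet> w = w \<bullet> w" by (simp add: w_def inner_diff_left)
    finally have "s * (2 * (w \<bullet> w)) \<le> s * (s * c)" by (simp add: power2_eq_square algebra_simps)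
    then have "2 * (w \<bullet> w) \<le> s * c" using s by simp
    also have "s * c \<le> w \<bullet> w" using c ww by (simp add: s_def field_simps)
    finally show False using ww by simp
  qed
  then have "T v = l *\<^sub>R v" by (simp add: w_def)
  with v that show thesis by blast
qed

text \<open>The spectral theorem. An orthonormal set of eigenvectors of maximal size spans the space, since its orthogonal
  complement is invariant and would otherwise contain another eigenvector.\<close>

lemma ex_orthonormal_eigenbasis:
  fixes T :: "'a::euclidean_space \<Rightarrow> 'a"
  assumes lin: "linear T" and sa: "\<And>x y. T x \<bullet> y = x \<bullet> T y"
  obtains B l where "orthonormal_basis_of B UNIV" "\<And>b. b \<in> B \<Longrightarrow> T b = l b *\<^sub>R b"
proof -
  define good where "good B \<longleftrightarrow> pairwise orthogonal B \<and> (\<forall>b\<in>B. norm b = 1 \<and> (\<exists>l. T b = l *\<^sub>R b))" for B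
  have fin: "finite B \<and> card B \<le> DIM('a)" if "good B" for B
  proof -
    have "0 \<notin> B" using that by (auto simp: good_def)
    then have "independent B" using that pairwise_orthogonal_independent by (auto simp: good_def)
    then show ?thesis using independent_bound by blast
  qed
  have "good {}" by (simp add: good_def)
  then obtain B where B: "good B" and maxB: "\<And>C. good C \<Longrightarrow> card C \<le> card B"
    using ex_has_greatest_nat[of good "{}" card "Suc DIM('a)"] fin by (auto simp: less_Suc_eq_le)
  define V where "V = {x. \<forall>b\<in>B. orthogonal x b}"
  have V: "subspace V"
    by (auto simp: V_def subspace_def orthogonal_def inner_add_left)
  have V0: "V = {0}"
  proof (rule ccontr)
    assume ne: "V \<noteq> {0}"
    have "T x \<in> V" if "x \<in> V" for x
    proof -
      have "T x \<bullet> b = 0" if "b \<in> B" for b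
        using that B \<open>x \<in> V\<close> sa[of x b] by (auto simp: good_def V_def orthogonal_def)
      then show ?thesis by (simp add: V_def orthogonal_def)
    qed
    from ex_eigenvector_in_subspace[OF lin sa V this ne] obtain v l
      where v: "v \<in> V" "norm v = 1" "T v = l *\<^sub>R v" by blast
    have "v \<notin> B" using v(1,2) by (auto simp: V_def orthogonal_def)
    moreover have "good (insert v B)"
      using B v by (auto simp: good_def V_def pairwise_insert orthogonal_commute)
    ultimately show False using maxB[of "insert v B"] fin[OF B] by simp
  qed
  have "span B = UNIV"
  proof (intro equalityI subsetI)
    fix x :: 'a
    have "x \<in> span B + (span B)\<^sup>\<bottom>" using subspace_sum_orthogonal_comp[OF subspace_span[of B]] by simp
    then obtain y z where yz: "x = y + z" "y \<in> span B" "z \<in> (span B)\<^sup>\<bottom>" by (rule set_plus_elim)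
    have "z \<in> V" using yz(3) by (auto simp: V_def orthogonal_comp_def span_base orthogonal_commute)
    then show "x \<in> span B" using V0 yz by simp
  qed simp
  then have "orthonormal_basis_of B UNIV" using B by (simp add: orthonormal_basis_of_def good_def)
  moreover obtain l where "\<And>b. b \<in> B \<Longrightarrow> T b = l b *\<^sub>R b" using B unfolding good_def by metis
  ultimately show thesis by (rule that)
qed

lemma parseval_orthonormal_basis:
  assumes "orthonormal_basis_of B (UNIV :: 'a::euclidean_space set)"
  shows "(\<Sum>b\<in>B. (b \<bullet> x)\<^sup>2) = (norm x)\<^sup>2"
proof -
  note Bp = orthonormal_basis_of_props[OF assms]
  have "x \<in> span B" using assms by (simp add: orthonormal_basis_of_def)
  then have x: "x = (\<Sum>b\<in>B. (b \<bullet> x) *\<^sub>R b)"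
  proof -
    have "pairwise orthogonal B" "\<And>b. b \<in> B \<Longrightarrow> norm b = 1" using assms by (auto simp: orthonormal_basis_of_def)
    from orthonormal_basis_expand[OF this \<open>x \<in> span B\<close> Bp(1)] show ?thesis by (simp add: inner_commute)
  qed
  have "(norm x)\<^sup>2 = x \<bullet> (\<Sum>b\<in>B. (b \<bullet> x) *\<^sub>R b)" using x by (simp add: power2_norm_eq_inner)
  also have "\<dots> = (\<Sum>b\<in>B. (b \<bullet> x)\<^sup>2)" by (simp add: inner_sum_right power2_eq_square inner_commute)
  finally show ?thesis by simp
qed

lemma det_eq_prod_eigenvalues:
  fixes T :: "real ^ 'n \<Rightarrow> real ^ 'n"
  assumes lin: "linear T" and B: "orthonormal_basis_of B UNIV" and ev: "\<And>b. b \<in> B \<Longrightarrow> T b = l b *\<^sub>R b"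
  shows "det (matrix T) = (\<Prod>b\<in>B. l b)"
proof -
  note Bp = orthonormal_basis_of_props[OF B]
  obtain h :: "'n \<Rightarrow> real ^ 'n" where h: "bij_betw h UNIV B"
    using finite_same_card_bij[of "UNIV :: 'n set" B] Bp(1,3) by auto
  have hB: "h i \<in> B" for i using h by (auto simp: bij_betw_def)
  have hh: "h i \<bullet> h j = (if i = j then 1 else 0)" for i j
    using Bp(4)[OF hB hB] h by (auto simp: bij_betw_def inj_def)
  define Q :: "real ^ 'n ^ 'n" where "Q = (\<chi> i j. h j $ i)"
  define D :: "real ^ 'n ^ 'n" where "D = (\<chi> i j. if i = j then l (h j) else 0)"
  have "transpose Q ** Q = mat 1"
    using hh by (simp add: vec_eq_iff matrix_matrix_mult_def transpose_def Q_def mat_def inner_vec_def)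
  then have "det (transpose Q) * det Q = 1" by (metis det_mul det_I)
  then have Q0: "det Q \<noteq> 0" by auto
  have "matrix T ** Q = Q ** D"
  proof -
    have "(matrix T ** Q) $ i $ j = (Q ** D) $ i $ j" for i j
    proof -
      have "(matrix T ** Q) $ i $ j = (matrix T *v h j) $ i"
        by (simp add: matrix_matrix_mult_def matrix_vector_mult_def Q_def)
      also have "\<dots> = l (h j) * h j $ i" using lin ev[OF hB] by (simp add: matrix_works)
      also have "\<dots> = (Q ** D) $ i $ j"
        by (simp add: matrix_matrix_mult_def Q_def D_def if_distrib cong: if_cong)
      finally show ?thesis .
    qed
    then show ?thesis by (simp add: vec_eq_iff)
  qed
  then have "det (matrix T) * det Q = det Q * det D" by (metis det_mul)
  then have "det (matrix T) = det D" using Q0 by simp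
  also have "\<dots> = (\<Prod>i\<in>UNIV. l (h i))" by (subst det_diagonal) (auto simp: D_def)
  also have "\<dots> = (\<Prod>b\<in>B. l b)" by (rule prod.reindex_bij_betw[OF h])
  finally show ?thesis .
qed

text \<open>Jensen's inequality for the logarithm, from the tangent line at the weighted mean. One weight is
  kept apart from the indexed ones because it will belong to the kernel of a projection.\<close>

lemma weighted_sum_ln_le:
  assumes "finite J" "w0 \<ge> 0" "\<And>j. j \<in> J \<Longrightarrow> w j \<ge> 0" "w0 + (\<Sum>j\<in>J. w j) = 1"
    and "a > (0::real)" "\<And>j. j \<in> J \<Longrightarrow> d j > 0"
  defines "\<mu> \<equiv> w0 * a + (\<Sum>j\<in>J. w j * d j)"
  shows "\<mu> > 0" "w0 * ln a + (\<Sum>j\<in>J. w j * ln (d j)) \<le> ln \<mu>"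
proof -
  have nn: "(\<Sum>j\<in>J. w j * d j) \<ge> 0" using assms by (intro sum_nonneg mult_nonneg_nonneg) (auto intro: less_imp_le)
  show pos: "\<mu> > 0"
  proof (cases "w0 = 0")
    case False
    then have "w0 * a > 0" using assms by simp
    then show ?thesis using nn by (simp add: \<mu>_def)
  next
    case True
    then obtain j where j: "j \<in> J" "w j \<noteq> 0" using assms(4) by (metis add_0 sum.neutral zero_neq_one)
    have "0 < w j * d j" using j assms by (simp add: less_le)
    also have "\<dots> \<le> (\<Sum>j\<in>J. w j * d j)"
      using assms j by (intro member_le_sum) (auto intro: less_imp_le mult_nonneg_nonneg)
    finally show ?thesis using True by (simp add: \<mu>_def)
  qed
  have le: "ln x \<le> x / \<mu> - 1 + ln \<mu>" if "x > 0" for x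
    using ln_le_minus_one[of "x / \<mu>"] that pos by (simp add: ln_div)
  have "w0 * ln a + (\<Sum>j\<in>J. w j * ln (d j)) \<le> w0 * (a / \<mu> - 1 + ln \<mu>) + (\<Sum>j\<in>J. w j * (d j / \<mu> - 1 + ln \<mu>))"
    using assms by (intro add_mono mult_left_mono sum_mono le) auto
  also have "(\<Sum>j\<in>J. w j * (d j / \<mu> - 1 + ln \<mu>)) = (\<Sum>j\<in>J. w j * d j) / \<mu> + (\<Sum>j\<in>J. w j) * (ln \<mu> - 1)"
    unfolding sum_divide_distrib sum_distrib_right sum.distrib[symmetric]
    by (intro sum.cong refl) (simp add: algebra_simps)
  also have "w0 * (a / \<mu> - 1 + ln \<mu>) + \<dots> = \<mu> / \<mu> + (w0 + (\<Sum>j\<in>J. w j)) * (ln \<mu> - 1)"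
    by (subst (3) \<mu>_def) (simp add: add_divide_distrib algebra_simps)
  also have "\<dots> = ln \<mu>" using pos assms(4) by simp
  finally show "w0 * ln a + (\<Sum>j\<in>J. w j * ln (d j)) \<le> ln \<mu>" .
qed

text \<open>For a unit eigenvector \<open>b\<close> the eigenvalue \<open>M b \<bullet> b\<close> is the mean of \<open>a\<close> and the \<open>d\<^sub>j\<close> with the
  weights \<open>1 - \<parallel>P b\<parallel>\<^sup>2\<close> and \<open>(P b)\<^sub>j\<^sup>2\<close>, so its logarithm is at least the mean of the logarithms.
  Summed over an orthonormal eigenbasis, the weights of \<open>d\<^sub>j\<close> give \<open>\<parallel>P e\<^sub>j\<parallel>\<^sup>2\<close> by Parseval's identity.\<close>

lemma ln_det_compression_ge:
  fixes P :: "real ^ 'n \<Rightarrow> real ^ 'n" and d :: "'n \<Rightarrow> real"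
  assumes lin: "linear P" and idem: "\<And>x. P (P x) = P x" and sa: "\<And>x y. P x \<bullet> y = x \<bullet> P y"
    and d: "\<And>j. d j > 0" and a: "a > 0"
  defines "M \<equiv> \<lambda>x. a *\<^sub>R (x - P x) + P (\<chi> j. d j * P x $ j)"
  shows "det (matrix M) > 0"
    and "(\<Sum>j\<in>UNIV. (1 - (norm (P (axis j 1)))\<^sup>2) * ln a + (norm (P (axis j 1)))\<^sup>2 * ln (d j)) \<le> ln (det (matrix M))"
proof -
  note Pl = linear_add[OF lin] linear_scale[OF lin] linear_diff[OF lin]
  have linM: "linear M"
  proof (rule linearI)
    fix x y :: "real ^ 'n" and c
    have "(\<chi> j. d j * P (x + y) $ j) = (\<chi> j. d j * P x $ j) + (\<chi> j. d j * P y $ j)"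
      by (simp add: vec_eq_iff Pl algebra_simps)
    then show "M (x + y) = M x + M y" by (simp add: M_def Pl algebra_simps)
    have "(\<chi> j. d j * P (c *\<^sub>R x) $ j) = c *\<^sub>R (\<chi> j. d j * P x $ j)"
      by (simp add: vec_eq_iff Pl algebra_simps)
    then show "M (c *\<^sub>R x) = c *\<^sub>R M x" by (simp add: M_def Pl algebra_simps)
  qed
  have Minner: "M x \<bullet> y = a * (x \<bullet> y - P x \<bullet> P y) + (\<Sum>j\<in>UNIV. d j * P x $ j * P y $ j)" for x y
  proof -
    have "(\<chi> j. d j * P x $ j) \<bullet> P y = (\<Sum>j\<in>UNIV. d j * P x $ j * P y $ j)"
      by (simp add: inner_vec_def)
    moreover have "P x \<bullet> y = P x \<bullet> P y" using sa[of "P x" y] by (simp add: idem)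
    ultimately show ?thesis by (simp add: M_def inner_add_left inner_diff_left sa[of "\<chi> j. _ j" y])
  qed
  then have "M x \<bullet> y = x \<bullet> M y" for x y
    by (subst inner_commute[of x]) (simp add: Minner inner_commute mult_ac)
  from ex_orthonormal_eigenbasis[OF linM this] obtain B l
    where B: "orthonormal_basis_of B UNIV" and ev: "\<And>b. b \<in> B \<Longrightarrow> M b = l b *\<^sub>R b" by blast
  note Bp = orthonormal_basis_of_props[OF B]
  have P1: "(norm (P b))\<^sup>2 \<le> 1" "(1 - (norm (P b))\<^sup>2) + (\<Sum>j\<in>UNIV. (P b $ j)\<^sup>2) = 1" 
    and l_eq: "l b = (1 - (norm (P b))\<^sup>2) * a + (\<Sum>j\<in>UNIV. (P b $ j)\<^sup>2 * d j)" if "b \<in> B" for b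
  proof -
    have bb: "b \<bullet> b = 1" using Bp(4)[OF that that] by simp
    have "(b - P b) \<bullet> (b - P b) = 1 - P b \<bullet> P b"
      using sa[of "P b" b] bb by (simp add: inner_diff_left inner_diff_right sa idem)
    then show "(norm (P b))\<^sup>2 \<le> 1" using inner_ge_zero[of "b - P b"] by (simp add: power2_norm_eq_inner)
    show "(1 - (norm (P b))\<^sup>2) + (\<Sum>j\<in>UNIV. (P b $ j)\<^sup>2) = 1"
      by (simp add: norm_vec_square)
    have "l b = M b \<bullet> b" using ev[OF that] bb by simp
    then show "l b = (1 - (norm (P b))\<^sup>2) * a + (\<Sum>j\<in>UNIV. (P b $ j)\<^sup>2 * d j)"
      using bb by (simp add: Minner power2_norm_eq_inner) (simp add: power2_eq_square mult_ac)
  qed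
  have lpos: "l b > 0"
    and lln: "(1 - (norm (P b))\<^sup>2) * ln a + (\<Sum>j\<in>UNIV. (P b $ j)\<^sup>2 * ln (d j)) \<le> ln (l b)" if "b \<in> B" for b
    using weighted_sum_ln_le[of UNIV "1 - (norm (P b))\<^sup>2" "\<lambda>j. (P b $ j)\<^sup>2" a d] P1[OF that] d a
    by (auto simp: l_eq[OF that])
  have det: "det (matrix M) = (\<Prod>b\<in>B. l b)" by (rule det_eq_prod_eigenvalues[OF linM B ev])
  then show "det (matrix M) > 0" using lpos by (simp add: prod_pos)
  have col: "(\<Sum>b\<in>B. (P b $ j)\<^sup>2) = (norm (P (axis j 1)))\<^sup>2" for j
    using parseval_orthonormal_basis[OF B, of "P (axis j 1)"]
    by (simp add: sa[symmetric] inner_axis)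
  have tr: "(\<Sum>b\<in>B. (norm (P b))\<^sup>2) = (\<Sum>j\<in>UNIV. (norm (P (axis j 1)))\<^sup>2)"
  proof -
    have "(\<Sum>b\<in>B. (norm (P b))\<^sup>2) = (\<Sum>b\<in>B. \<Sum>j\<in>UNIV. (P b $ j)\<^sup>2)"
      by (simp add: norm_vec_square)
    also have "\<dots> = (\<Sum>j\<in>UNIV. \<Sum>b\<in>B. (P b $ j)\<^sup>2)" by (rule sum.swap)
    finally show ?thesis by (simp add: col)
  qed
  have "card B = CARD('n)" using Bp(3) by simp
  then have "(\<Sum>j\<in>UNIV. (1 - (norm (P (axis j 1)))\<^sup>2) * ln a + (norm (P (axis j 1)))\<^sup>2 * ln (d j))
     = (\<Sum>b\<in>B. (1 - (norm (P b))\<^sup>2)) * ln a + (\<Sum>j\<in>UNIV. (\<Sum>b\<in>B. (P b $ j)\<^sup>2) * ln (d j))"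
    by (simp add: sum.distrib sum_distrib_right[symmetric] sum_subtractf tr col)
  also have "\<dots> = (\<Sum>b\<in>B. (1 - (norm (P b))\<^sup>2) * ln a + (\<Sum>j\<in>UNIV. (P b $ j)\<^sup>2 * ln (d j)))"
    by (simp add: sum.distrib sum_distrib_right sum.swap[of _ B UNIV])
  also have "\<dots> \<le> (\<Sum>b\<in>B. ln (l b))" by (intro sum_mono lln)
  also have "\<dots> = ln (det (matrix M))" unfolding det using lpos by (intro ln_prod[symmetric] Bp(1)) (metis less_irrefl)
  finally show "(\<Sum>j\<in>UNIV. (1 - (norm (P (axis j 1)))\<^sup>2) * ln a + (norm (P (axis j 1)))\<^sup>2 * ln (d j)) \<le> ln (det (matrix M))" .
qed

text \<open>The two maps differ by a block that sends the kernel of \<open>P\<close> into its range; multiplication by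
  the unipotent map \<open>U = 1 + K\<close>, where \<open>K\<close> is that block divided by \<open>a\<close>, adds it. Conjugation by \<open>L = 1 + P\<close> doubles \<open>K\<close>,
  and \<open>U \<circ> U = 1 + 2 K\<close>. Hence the invertible map \<open>U\<close> and its square have the same determinant, which must be one.\<close>

lemma det_block_triangular_eq:
  fixes P :: "real ^ 'n \<Rightarrow> real ^ 'n" and d :: "'n \<Rightarrow> real"
  assumes lin: "linear P" and idem: "\<And>x. P (P x) = P x" and a: "a > 0"
  shows "det (matrix (\<lambda>x. a *\<^sub>R (x - P x) + P (\<chi> j. d j * x $ j)))
    = det (matrix (\<lambda>x. a *\<^sub>R (x - P x) + P (\<chi> j. d j * P x $ j)))"
proof -
  define D :: "real ^ 'n \<Rightarrow> real ^ 'n" where "D x = (\<chi> j. d j * x $ j)" for x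
  have linD: "linear D" by (rule linearI) (auto simp: D_def vec_eq_iff algebra_simps)
  note simps = linear_add[OF lin] linear_scale[OF lin] linear_diff[OF lin]
    linear_add[OF linD] linear_scale[OF linD] linear_diff[OF linD] linear_0[OF lin] linear_0[OF linD] idem
  define K where "K x = (1 / a) *\<^sub>R P (D (x - P x))" for x
  define U where "U x = x + K x" for x
  define L where "L x = x + P x" for x
  define M where "M x = a *\<^sub>R (x - P x) + P (D (P x))" for x
  define N where "N x = a *\<^sub>R (x - P x) + P (D x)" for x
  have linK: "linear K" by (rule linearI) (simp_all add: K_def simps algebra_simps)
  have linU: "linear U" unfolding U_def by (intro linear_compose_add linK linear_id[unfolded id_def])
  have linL: "linear L" unfolding L_def by (intro linear_compose_add lin linear_id[unfolded id_def])
  have linM: "linear M" by (rule linearI) (simp_all add: M_def simps algebra_simps)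
  have KK: "K (K x) = 0" and PK: "P (K x) = K x" and KP: "K (P x) = 0" for x
    by (simp_all add: K_def simps)
  have "N = U \<circ> M"
  proof
    fix x
    have "M x - P (M x) = a *\<^sub>R (x - P x)" by (simp add: M_def simps)
    then have "K (M x) = P (D (x - P x))" using a by (simp add: K_def simps)
    then show "N x = (U \<circ> M) x" by (simp add: N_def U_def M_def simps)
  qed
  then have NM: "det (matrix N) = det (matrix U) * det (matrix M)"
    by (simp add: matrix_compose linU linM det_mul)
  have "(U \<circ> U) \<circ> L = L \<circ> U"
    by (auto simp: fun_eq_iff U_def L_def linear_add[OF linK] simps KK PK KP)
  then have "matrix ((U \<circ> U) \<circ> L) = matrix (L \<circ> U)" by simp
  then have "matrix U ** matrix U ** matrix L = matrix L ** matrix U"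
    by (simp add: matrix_compose linU linL linear_compose)
  then have eq: "det (matrix U) * det (matrix U) * det (matrix L) = det (matrix L) * det (matrix U)"
    by (metis det_mul)
  have inv: "det (matrix f) \<noteq> 0" if "linear f" "linear g" "f \<circ> g = id" for f g :: "real ^ 'n \<Rightarrow> real ^ 'n"
  proof -
    have "matrix f ** matrix g = mat 1" using that matrix_compose[of g f] by (simp add: matrix_id_mat_1)
    then have "det (matrix f) * det (matrix g) = 1" by (metis det_mul det_I)
    then show ?thesis by auto
  qed
  have "det (matrix U) \<noteq> 0"
  proof (rule inv[OF linU])
    show "linear (\<lambda>x. x - K x)" by (intro linear_compose_sub linK linear_id[unfolded id_def])
    show "U \<circ> (\<lambda>x. x - K x) = id" by (auto simp: fun_eq_iff U_def linear_diff[OF linK] KK)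
  qed
  moreover have "det (matrix L) \<noteq> 0"
  proof (rule inv[OF linL])
    show "linear (\<lambda>x. x - (1/2) *\<^sub>R P x)"
      by (rule linearI) (simp_all add: simps algebra_simps)
    show "L \<circ> (\<lambda>x. x - (1/2) *\<^sub>R P x) = id"
      by (auto simp: fun_eq_iff L_def simps)
  qed
  ultimately have "det (matrix U) = 1" using eq by simp
  then show ?thesis using NM by (simp add: N_def[abs_def] M_def[abs_def] D_def)
qed

section \<open>The geometric Brascamp--Lieb inequality for a projection\<close>

text \<open>Only an inequality holds, because the range of \<open>g\<close> may miss part of the space.\<close>

lemma nn_integral_change_of_variables_le:
  fixes h :: "real ^ 'm::{finite,wellorder} \<Rightarrow> real" and g :: "real ^ 'm::_ \<Rightarrow> real ^ 'm::_"
  assumes h: "integrable lborel h" "\<And>y. h y \<ge> 0"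
    and g: "\<And>x. (g has_derivative g' x) (at x)" "inj g"
  shows "(\<integral>\<^sup>+x. ennreal (\<bar>det (matrix (g' x))\<bar> * h (g x)) \<partial>lborel) \<le> ennreal (integral\<^sup>L lborel h)"
proof -
  have hI: "(h has_integral integral\<^sup>L lborel h) UNIV" by (rule has_integral_integral_lborel[OF h(1)])
  have hU: "h absolutely_integrable_on UNIV"
    using hI h(2) by (intro nonnegative_absolutely_integrable_1) auto
  have "range g \<in> sets lebesgue"
    using g(1) by (intro differentiable_image_in_sets_lebesgue) (auto simp: differentiable_on_def differentiable_def)
  then have hr: "h absolutely_integrable_on range g"
    by (rule set_integrable_subset[OF hU]) simp_all
  define b where "b = integral (range g) h"
  have b: "b \<le> integral\<^sup>L lborel h"
    unfolding b_def using hI h(2) hr set_lebesgue_integral_eq_integral(1)[OF hr]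
    by (metis integral_subset_le integral_unique has_integral_integrable subset_UNIV)
  have "(\<lambda>x. \<bar>det (matrix (g' x))\<bar> *\<^sub>R (vec (h (g x)) :: real ^ 1)) absolutely_integrable_on UNIV \<and>
      integral UNIV (\<lambda>x. \<bar>det (matrix (g' x))\<bar> *\<^sub>R (vec (h (g x)) :: real ^ 1)) = vec b
    \<longleftrightarrow> (\<lambda>y. vec (h y) :: real ^ 1) absolutely_integrable_on range g \<and> integral (range g) (\<lambda>y. vec (h y) :: real ^ 1) = vec b"
    by (rule has_absolute_integral_change_of_variables) (use g in auto)
  then have "(\<lambda>x. \<bar>det (matrix (g' x))\<bar> * h (g x)) absolutely_integrable_on UNIV \<and>
      integral UNIV (\<lambda>x. \<bar>det (matrix (g' x))\<bar> * h (g x)) = b"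
    using hr b_def by (simp add: absolutely_integrable_on_1_iff integral_on_1_eq)
  then have "((\<lambda>x. \<bar>det (matrix (g' x))\<bar> * h (g x)) has_integral b) UNIV"
    using set_lebesgue_integral_eq_integral(1) by (metis integrable_integral)
  from nn_integral_has_integral_lebesgue[OF _ this] h(2)
  have "(\<integral>\<^sup>+x. ennreal (\<bar>det (matrix (g' x))\<bar> * h (g x)) \<partial>lborel) = ennreal b" by simp
  then show ?thesis using b by (simp add: ennreal_leI)
qed

lemma has_derivative_diagonal:
  fixes S s :: "'n::finite \<Rightarrow> real \<Rightarrow> real"
  assumes "\<And>j t. (S j has_real_derivative s j t) (at t)"
  shows "((\<lambda>x. \<chi> j. S j (x $ j)) has_derivative (\<lambda>v. \<chi> j. s j (x $ j) * v $ j)) (at (x :: real ^ 'n))"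
proof (rule has_derivative_componentwise_within[THEN iffD2], intro ballI)
  fix b :: "real ^ 'n" assume "b \<in> Basis"
  then obtain i where b: "b = axis i 1" by (auto simp: Basis_vec_def)
  have "((\<lambda>x :: real ^ 'n. x $ i) has_derivative (\<lambda>v. v $ i)) (at x)"
    by (rule bounded_linear.has_derivative[OF bounded_linear_vec_nth has_derivative_ident])
  moreover have "(S i has_derivative (*) (s i (x $ i))) (at (x $ i))"
    using assms[of i "x $ i"] by (simp add: has_field_derivative_def)
  ultimately have "((\<lambda>x :: real ^ 'n. S i (x $ i)) has_derivative (\<lambda>v. s i (x $ i) * v $ i)) (at x)"
    by (rule has_derivative_compose[of "\<lambda>x. x $ i"])
  then show "((\<lambda>x. (\<chi> j. S j (x $ j)) \<bullet> b) has_derivative (\<lambda>v. (\<chi> j. s j (x $ j) * v $ j) \<bullet> b)) (at x)"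
    by (simp add: b inner_axis)
qed

lemma projection_pythagoras:
  fixes P :: "'a::euclidean_space \<Rightarrow> 'a"
  assumes lin: "linear P" and idem: "\<And>x. P (P x) = P x" and sa: "\<And>x y. P x \<bullet> y = x \<bullet> P y"
  shows "(norm (a *\<^sub>R (x - P x) + P y))\<^sup>2 = (norm (a *\<^sub>R (x - P x)))\<^sup>2 + (norm (P y))\<^sup>2"
    and "norm (P y) \<le> norm y"
proof -
  have "(x - P x) \<bullet> P y = 0" for x y by (simp add: sa[symmetric] linear_diff[OF lin] idem)
  then show 1: "(norm (a *\<^sub>R (x - P x) + P y))\<^sup>2 = (norm (a *\<^sub>R (x - P x)))\<^sup>2 + (norm (P y))\<^sup>2" for a x y
    by (simp only: norm_add_Pythagorean orthogonal_def inner_scaleR_left mult_zero_right)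
  from 1[of 1 y y] have "(norm (P y))\<^sup>2 \<le> (norm y)\<^sup>2" by simp
  then show "norm (P y) \<le> norm y" by simp
qed

text \<open>The map \<open>g x = a (x - P x) + P (S\<^sub>j (x\<^sub>j))\<^sub>j\<close> built from the one-dimensional transport maps satisfies
  \<open>\<parallel>g x\<parallel>\<^sup>2 \<le> a\<^sup>2 \<parallel>x - P x\<parallel>\<^sup>2 + \<Sum>\<^sub>j (S\<^sub>j (x\<^sub>j))\<^sup>2\<close>, and its Jacobian dominates
  \<open>a powr (dim ker P) * \<Prod>\<^sub>j (S\<^sub>j' (x\<^sub>j)) powr \<parallel>P e\<^sub>j\<parallel>\<^sup>2\<close>. The integrand is thus at most a constant times the
  pull-back of the standard Gaussian under the injective map \<open>g\<close>, and that has integral at most one.\<close>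

lemma brascamp_lieb_projection_wellorder:
  fixes P :: "real ^ 'm::{finite,wellorder} \<Rightarrow> real ^ 'm::_" and f :: "'m \<Rightarrow> real \<Rightarrow> real"
  assumes lin: "linear P" and idem: "\<And>x. P (P x) = P x" and sa: "\<And>x y. P x \<bullet> y = x \<bullet> P y"
    and p: "\<And>j. P (axis j 1) \<noteq> 0" and a: "a > 0"
    and f: "\<And>j. continuous_on UNIV (f j)" "\<And>j t. f j t > 0" "\<And>j. integrable lborel (f j)"
  shows "(\<integral>\<^sup>+x. ennreal (exp (- pi * (norm (a *\<^sub>R (x - P x)))\<^sup>2) * (\<Prod>j\<in>UNIV. f j (x $ j) powr (norm (P (axis j 1)))\<^sup>2)) \<partial>lborel)
    \<le> ennreal (a powr (- (\<Sum>j\<in>UNIV. 1 - (norm (P (axis j 1)))\<^sup>2))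
        * (\<Prod>j\<in>UNIV. (integral\<^sup>L lborel (f j) / norm (P (axis j 1))) powr (norm (P (axis j 1)))\<^sup>2))"
proof -
  note Pl = linear_add[OF lin] linear_scale[OF lin] linear_diff[OF lin]
  define p where "p j = norm (P (axis j 1))" for j :: 'm
  have p0: "p j > 0" for j using p by (simp add: p_def)
  have "\<exists>S s. (\<forall>t. (S has_real_derivative s t) (at t)) \<and> (\<forall>t. s t > 0) \<and>
    (\<forall>t. f j t powr (p j)\<^sup>2 = (integral\<^sup>L lborel (f j) / p j) powr (p j)\<^sup>2 * (exp (- pi * (S t)\<^sup>2) * s t powr (p j)\<^sup>2))" for j
    using ex_transport_to_gaussian[OF f(1) f(2) f(3) p0, of j j] by metis
  then obtain S s where dS: "\<And>j t. (S j has_real_derivative s j t) (at t)" and s: "\<And>j t. s j t > 0"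
    and fS: "\<And>j t. f j t powr (p j)\<^sup>2 = (integral\<^sup>L lborel (f j) / p j) powr (p j)\<^sup>2 * (exp (- pi * (S j t)\<^sup>2) * s j t powr (p j)\<^sup>2)"
    by metis
  define C where "C = (\<Prod>j\<in>UNIV. (integral\<^sup>L lborel (f j) / p j) powr (p j)\<^sup>2)"
  have C: "C \<ge> 0" unfolding C_def by (intro prod_nonneg) simp
  define q where "q = (\<Sum>j\<in>UNIV. 1 - (p j)\<^sup>2)"
  define g where "g x = a *\<^sub>R (x - P x) + P (\<chi> j. S j (x $ j))" for x
  define g' where "g' x v = a *\<^sub>R (v - P v) + P (\<chi> j. s j (x $ j) * v $ j)" for x v
  have bl: "bounded_linear P" using lin by (simp add: linear_conv_bounded_linear)
  have dg: "(g has_derivative g' x) (at x)" for x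
    unfolding g_def g'_def
    by (intro derivative_intros bounded_linear.has_derivative[OF bl] has_derivative_diagonal dS)
  have "inj g"
  proof (rule injI)
    fix x y assume eq: "g x = g y"
    have "g x - P (g x) = a *\<^sub>R (x - P x)" for x by (simp add: g_def Pl idem)
    then have 1: "x - P x = y - P y" using eq a by (metis scaleR_cancel_left less_irrefl)
    have 2: "P (\<chi> j. S j (x $ j)) = P (\<chi> j. S j (y $ j))" using eq 1 by (simp add: g_def)
    have xy: "P (x - y) = x - y" using 1 by (simp add: Pl algebra_simps)
    \<comment> \<open>The difference \<open>x - y\<close> lies in the range of \<open>P\<close> and is orthogonal to the difference of the
    transported points, while a strictly increasing map moves distinct points in the same direction.\<close>
    have "(\<Sum>j\<in>UNIV. (S j (x $ j) - S j (y $ j)) * (x $ j - y $ j)) = ((\<chi> j. S j (x $ j)) - (\<chi> j. S j (y $ j))) \<bullet> P (x - y)"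
      unfolding xy by (simp add: inner_vec_def)
    also have "\<dots> = P ((\<chi> j. S j (x $ j)) - (\<chi> j. S j (y $ j))) \<bullet> (x - y)" by (rule sa[symmetric])
    also have "\<dots> = 0" unfolding Pl 2 by simp
    finally have sum0: "(\<Sum>j\<in>UNIV. (S j (x $ j) - S j (y $ j)) * (x $ j - y $ j)) = 0" .
    have mono: "strict_mono (S j)" for j
      by (rule strict_monoI) (rule DERIV_pos_imp_increasing; use dS s in blast)
    have pos: "(S j u - S j v) * (u - v) > 0" if "u \<noteq> v" for j u v
      using that strict_mono_less[OF mono[of j], of u v] strict_mono_less[OF mono[of j], of v u]
      by (cases "u < v") (auto intro: mult_neg_neg mult_pos_pos)
    have nn: "(S j u - S j v) * (u - v) \<ge> 0" for j u v
      using pos[of u v j] by (cases "u = v") auto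
    have "(S j (x $ j) - S j (y $ j)) * (x $ j - y $ j) = 0" for j
      using sum0 nn by (subst (asm) sum_nonneg_eq_0_iff) auto
    then show "x = y" unfolding vec_eq_iff using pos by (metis less_irrefl)
  qed
  let ?h = "\<lambda>y :: real ^ 'm::_. exp (- pi * (norm y)\<^sup>2)"
  have det: "a powr q * (\<Prod>j\<in>UNIV. s j (x $ j) powr (p j)\<^sup>2) \<le> \<bar>det (matrix (g' x))\<bar>" for x
  proof -
    let ?M = "\<lambda>v. a *\<^sub>R (v - P v) + P (\<chi> j. s j (x $ j) * P v $ j)"
    note D = ln_det_compression_ge[OF lin idem sa s a, of "\<lambda>j. j" "\<lambda>j. x $ j"]
    have eq: "det (matrix (g' x)) = det (matrix ?M)"
      unfolding g'_def using det_block_triangular_eq[OF lin idem a, of "\<lambda>j. s j (x $ j)"] by simp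
    have "ln (a powr q * (\<Prod>j\<in>UNIV. s j (x $ j) powr (p j)\<^sup>2))
      = (\<Sum>j\<in>UNIV. (1 - (p j)\<^sup>2) * ln a + (p j)\<^sup>2 * ln (s j (x $ j)))"
      using a s by (simp add: ln_mult prod_pos ln_prod ln_powr q_def sum.distrib sum_distrib_right less_imp_neq[symmetric])
    also have "\<dots> \<le> ln (det (matrix ?M))" using D(2) by (simp add: p_def)
    finally have "a powr q * (\<Prod>j\<in>UNIV. s j (x $ j) powr (p j)\<^sup>2) \<le> det (matrix ?M)"
      using D(1) a s by (subst (asm) ln_le_cancel_iff) (auto intro!: mult_pos_pos prod_pos simp: less_imp_neq[symmetric])
    then show ?thesis using eq by simp
  qed
  have pt: "exp (- pi * (norm (a *\<^sub>R (x - P x)))\<^sup>2) * (\<Prod>j\<in>UNIV. f j (x $ j) powr (p j)\<^sup>2)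
     \<le> a powr (- q) * C * (\<bar>det (matrix (g' x))\<bar> * ?h (g x))" for x
  proof -
    let ?S = "\<chi> j. S j (x $ j)"
    have "(norm (g x))\<^sup>2 \<le> (norm (a *\<^sub>R (x - P x)))\<^sup>2 + (norm ?S)\<^sup>2"
      unfolding g_def projection_pythagoras(1)[OF lin idem sa]
      using projection_pythagoras(2)[OF lin idem sa] by (simp add: power_mono)
    then have "pi * (norm (g x))\<^sup>2 \<le> pi * ((norm (a *\<^sub>R (x - P x)))\<^sup>2 + (norm ?S)\<^sup>2)"
      by (intro mult_left_mono) simp_all
    then have h: "exp (- pi * (norm (a *\<^sub>R (x - P x)))\<^sup>2) * exp (- pi * (norm ?S)\<^sup>2) \<le> ?h (g x)"
      by (simp add: mult_exp_exp distrib_left)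
    have nS: "exp (- pi * (norm ?S)\<^sup>2) = (\<Prod>j\<in>UNIV. exp (- pi * (S j (x $ j))\<^sup>2))"
      by (simp add: norm_vec_square exp_sum[symmetric] sum_distrib_left sum_negf)
    have "exp (- pi * (norm (a *\<^sub>R (x - P x)))\<^sup>2) * (\<Prod>j\<in>UNIV. f j (x $ j) powr (p j)\<^sup>2)
      = C * ((\<Prod>j\<in>UNIV. s j (x $ j) powr (p j)\<^sup>2) * (exp (- pi * (norm (a *\<^sub>R (x - P x)))\<^sup>2) * exp (- pi * (norm ?S)\<^sup>2)))"
      unfolding fS nS prod.distrib C_def by (simp add: mult_ac)
    also have "\<dots> \<le> C * ((\<Prod>j\<in>UNIV. s j (x $ j) powr (p j)\<^sup>2) * ?h (g x))"
      using h C by (intro mult_left_mono prod_nonneg) auto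
    also have "\<dots> = a powr (- q) * C * ((a powr q * (\<Prod>j\<in>UNIV. s j (x $ j) powr (p j)\<^sup>2)) * ?h (g x))"
      using a by (simp add: powr_minus)
    also have "\<dots> \<le> a powr (- q) * C * (\<bar>det (matrix (g' x))\<bar> * ?h (g x))"
      using C det by (intro mult_left_mono mult_right_mono) auto
    finally show ?thesis .
  qed
  define K where "K = a powr (- q) * C"
  have K: "K \<ge> 0" using C by (simp add: K_def)
  have "(\<integral>\<^sup>+x. ennreal (exp (- pi * (norm (a *\<^sub>R (x - P x)))\<^sup>2) * (\<Prod>j\<in>UNIV. f j (x $ j) powr (p j)\<^sup>2)) \<partial>lborel)
     \<le> (\<integral>\<^sup>+x. ennreal (\<bar>det (matrix (g' x))\<bar> * (K * ?h (g x))) \<partial>lborel)"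
    using pt by (intro nn_integral_mono ennreal_leI) (simp add: K_def mult_ac)
  also have "\<dots> \<le> ennreal (\<integral>y. K * ?h y \<partial>lborel)"
    by (rule nn_integral_change_of_variables_le)
       (use K dg \<open>inj g\<close> in \<open>auto intro!: integrable_mult_right integral_standard_gaussian(1)[simplified]\<close>)
  also have "(\<integral>y. K * ?h y \<partial>lborel) = a powr (- q) * C"
    unfolding integral_mult_right_zero integral_standard_gaussian(2) by (simp add: K_def)
  finally show ?thesis unfolding p_def q_def C_def .
qed

text \<open>The order comes from an enumeration of the finite type. The copy is used to number the
  coordinates of \<open>\<real>\<^sup>n\<close>, so that an inequality for a linearly ordered coordinate system can be
  transported along an isometry that relabels coordinates.\<close>

typedef 'a well_ordered = "UNIV :: 'a set" by simp
instance well_ordered :: (finite) finite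
proof
  show "finite (UNIV :: 'a well_ordered set)"
    by (subst type_definition.Abs_image[OF type_definition_well_ordered, symmetric]) simp
qed
instantiation well_ordered :: (finite) wellorder
begin
definition "x \<le> y \<longleftrightarrow> to_nat (Rep_well_ordered x) \<le> to_nat (Rep_well_ordered y)"
definition "x < y \<longleftrightarrow> to_nat (Rep_well_ordered x) < to_nat (Rep_well_ordered y)"
instance
proof
  fix P :: "'a well_ordered \<Rightarrow> bool" and a
  assume *: "\<And>x. (\<And>y. y < x \<Longrightarrow> P y) \<Longrightarrow> P x"
  show "P a"
  proof (induction "to_nat (Rep_well_ordered a)" arbitrary: a rule: less_induct)
    case less
    show ?case by (rule *, rule less) (simp add: less_well_ordered_def)
  qed
qed (auto simp: less_well_ordered_def less_eq_well_ordered_def Rep_well_ordered_inject)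
end

text \<open>The geometric Brascamp--Lieb inequality for the unit vectors \<open>P e\<^sub>j / \<parallel>P e\<^sub>j\<parallel>\<close> with the weights
  \<open>\<parallel>P e\<^sub>j\<parallel>\<^sup>2\<close>. Instead of being restricted to the range of \<open>P\<close>, the integral has a Gaussian weight
  along the kernel, which costs the factor \<open>a powr (- dim ker P)\<close>. Translates of the range in the
  direction of the kernel are covered because translating the functions does not change
  their integrals.\<close>

lemma brascamp_lieb_projection:
  fixes P :: "real ^ 'n \<Rightarrow> real ^ 'n" and f :: "'n \<Rightarrow> real \<Rightarrow> real"
  assumes lin: "linear P" and idem: "\<And>x. P (P x) = P x" and sa: "\<And>x y. P x \<bullet> y = x \<bullet> P y"
    and p: "\<And>j. P (axis j 1) \<noteq> 0" and a: "a > 0"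
    and f: "\<And>j. continuous_on UNIV (f j)" "\<And>j t. f j t > 0" "\<And>j. integrable lborel (f j)"
  shows "(\<integral>\<^sup>+x. ennreal (exp (- pi * (norm (a *\<^sub>R (x - P x)))\<^sup>2) * (\<Prod>j\<in>UNIV. f j (x $ j) powr (norm (P (axis j 1)))\<^sup>2)) \<partial>lborel)
    \<le> ennreal (a powr (- (\<Sum>j\<in>UNIV. 1 - (norm (P (axis j 1)))\<^sup>2))
        * (\<Prod>j\<in>UNIV. (integral\<^sup>L lborel (f j) / norm (P (axis j 1))) powr (norm (P (axis j 1)))\<^sup>2))"
    (is "(\<integral>\<^sup>+x. ennreal (?F x) \<partial>_) \<le> _")
proof -
  define A where "A = (Abs_well_ordered :: 'n \<Rightarrow> _)"
  define R where "R = (Rep_well_ordered :: _ \<Rightarrow> 'n)"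
  have AR: "A (R j) = j" "R (A i) = i" for i j
    by (simp_all add: A_def R_def Rep_well_ordered_inverse Abs_well_ordered_inverse)
  have bij: "bij_betw R UNIV UNIV" by (rule bij_betwI[where g=A]) (auto simp: AR)
  define \<rho> :: "real ^ 'n \<Rightarrow> real ^ 'n well_ordered" where "\<rho> x = (\<chi> j. x $ R j)" for x
  define \<sigma> :: "real ^ 'n well_ordered \<Rightarrow> real ^ 'n" where "\<sigma> y = (\<chi> i. y $ A i)" for y
  have inv: "\<rho> (\<sigma> y) = y" "\<sigma> (\<rho> x) = x" for x y by (simp_all add: \<rho>_def \<sigma>_def AR vec_eq_iff)
  have lin\<rho>: "linear \<rho>" and lin\<sigma>: "linear \<sigma>"
    by (auto intro!: linearI simp: \<rho>_def \<sigma>_def vec_eq_iff)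
  have inner: "\<rho> x \<bullet> y = x \<bullet> \<sigma> y" for x y
    using sum.reindex_bij_betw[OF bij, of "\<lambda>i. x $ i * y $ A i"]
    by (simp add: inner_vec_def \<rho>_def \<sigma>_def AR)
  have norm\<sigma>: "norm (\<sigma> y) = norm y" and norm\<rho>: "norm (\<rho> x) = norm x" for x y
    using inner[of "\<sigma> y" y] inner[of x "\<rho> x"] by (simp_all add: inv norm_eq_sqrt_inner)
  have ax: "\<rho> (axis i 1) = axis (A i) 1" and ax': "\<sigma> (axis j 1) = axis (R j) 1" for i j
    by (auto simp: \<rho>_def \<sigma>_def axis_def vec_eq_iff AR)
  define P' where "P' y = \<rho> (P (\<sigma> y))" for y
  have np: "norm (P' (axis j 1)) = norm (P (axis (R j) 1))" for j by (simp add: P'_def norm\<rho> ax')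
  have "distr lborel borel \<sigma> = subspace_lborel UNIV"
    by (rule subspace_lborel_eq_distr_isometry[symmetric]) (use lin\<sigma> norm\<sigma> surjI[of \<sigma> \<rho>] inv(2) in auto)
  also have "\<dots> = distr lborel borel (id :: real ^ 'n \<Rightarrow> _)"
    by (rule subspace_lborel_eq_distr_isometry) (auto simp: linear_id)
  also have "\<dots> = lborel" by (simp add: id_def distr_id2)
  finally have dist: "distr lborel borel \<sigma> = (lborel :: (real ^ 'n) measure)" .
  have [measurable]: "\<sigma> \<in> borel_measurable borel"
    using lin\<sigma> by (intro borel_measurable_continuous_onI linear_continuous_on) (simp add: linear_conv_bounded_linear)
  have [measurable]: "P \<in> borel_measurable borel"
    using lin by (intro borel_measurable_continuous_onI linear_continuous_on) (simp add: linear_conv_bounded_linear)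
  have [measurable]: "f j \<in> borel_measurable borel" for j
    by (intro borel_measurable_continuous_onI f(1))
  have "(\<integral>\<^sup>+x. ennreal (?F x) \<partial>lborel) = (\<integral>\<^sup>+x. ennreal (?F x) \<partial>distr lborel borel \<sigma>)" by (simp only: dist)
  also have "\<dots> = (\<integral>\<^sup>+y. ennreal (?F (\<sigma> y)) \<partial>lborel)"
    by (rule nn_integral_distr) measurable
  also have "\<dots> = (\<integral>\<^sup>+y. ennreal (exp (- pi * (norm (a *\<^sub>R (y - P' y)))\<^sup>2) * (\<Prod>j\<in>UNIV. f (R j) (y $ j) powr (norm (P' (axis j 1)))\<^sup>2)) \<partial>lborel)"
  proof (intro nn_integral_cong arg_cong[where f=ennreal] arg_cong2[where f="(*)"])
    fix y
    have "norm (a *\<^sub>R (y - P' y)) = norm (\<sigma> (a *\<^sub>R (y - P' y)))" by (simp only: norm\<sigma>)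
    also have "\<sigma> (a *\<^sub>R (y - P' y)) = a *\<^sub>R (\<sigma> y - P (\<sigma> y))"
      by (simp only: linear_scale[OF lin\<sigma>] linear_diff[OF lin\<sigma>] P'_def inv)
    finally show "exp (- pi * (norm (a *\<^sub>R (\<sigma> y - P (\<sigma> y))))\<^sup>2) = exp (- pi * (norm (a *\<^sub>R (y - P' y)))\<^sup>2)" by (simp only:)
    show "(\<Prod>j\<in>UNIV. f j (\<sigma> y $ j) powr (norm (P (axis j 1)))\<^sup>2) = (\<Prod>j\<in>UNIV. f (R j) (y $ j) powr (norm (P' (axis j 1)))\<^sup>2)"
      using prod.reindex_bij_betw[OF bij, of "\<lambda>j. f j (\<sigma> y $ j) powr (norm (P (axis j 1)))\<^sup>2"]
      by (simp add: np \<sigma>_def AR)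
  qed
  also have "\<dots> \<le> ennreal (a powr (- (\<Sum>j\<in>UNIV. 1 - (norm (P' (axis j 1)))\<^sup>2))
        * (\<Prod>j\<in>UNIV. (integral\<^sup>L lborel (f (R j)) / norm (P' (axis j 1))) powr (norm (P' (axis j 1)))\<^sup>2))"
  proof (rule brascamp_lieb_projection_wellorder)
    show "linear P'" unfolding P'_def
      using linear_compose[OF linear_compose[OF lin\<sigma> lin] lin\<rho>] by (simp add: o_def)
    show "P' (P' x) = P' x" for x by (simp add: P'_def inv idem)
    show "P' x \<bullet> y = x \<bullet> P' y" for x y
    proof -
      have "P' x \<bullet> y = \<sigma> x \<bullet> P (\<sigma> y)" by (simp only: P'_def inner sa)
      also have "\<dots> = \<rho> (P (\<sigma> y)) \<bullet> x" by (metis inner inner_commute)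
      finally show ?thesis unfolding P'_def by (simp only: inner_commute)
    qed
    show "P' (axis j 1) \<noteq> 0" for j using p[of "R j"] np[of j] by auto
  qed (use a f in auto)
  also have "(\<Sum>j\<in>UNIV. 1 - (norm (P' (axis j 1)))\<^sup>2) = (\<Sum>j\<in>UNIV. 1 - (norm (P (axis j 1)))\<^sup>2)"
    unfolding np by (rule sum.reindex_bij_betw[OF bij])
  also have "(\<Prod>j\<in>UNIV. (integral\<^sup>L lborel (f (R j)) / norm (P' (axis j 1))) powr (norm (P' (axis j 1)))\<^sup>2)
     = (\<Prod>j\<in>UNIV. (integral\<^sup>L lborel (f j) / norm (P (axis j 1))) powr (norm (P (axis j 1)))\<^sup>2)"
    unfolding np by (rule prod.reindex_bij_betw[OF bij])
  finally show ?thesis .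
qed

section \<open>Volume of the section\<close>

lemma nn_integral_exp_ell1: "(\<integral>\<^sup>+z. ennreal (exp (- (\<Sum>i\<in>UNIV. \<bar>z $ i\<bar>))) \<partial>(lborel :: (real ^ 'k) measure)) = ennreal (2 ^ CARD('k))"
proof -
  have h: "(\<integral>\<^sup>+t. ennreal (exp (- \<bar>t\<bar>)) \<partial>lborel) = 2"
  proof -
    have "{x::real. \<bar>x\<bar> \<le> 1} = {-1..1}" by auto
    then show ?thesis
      using nn_integral_exp_neg_homogeneous[of "\<lambda>t::real. \<bar>t\<bar>"] by (simp add: abs_mult)
  qed
  have "(\<integral>\<^sup>+z. ennreal (exp (- (\<Sum>i\<in>UNIV. \<bar>z $ i\<bar>))) \<partial>(lborel :: (real ^ 'k) measure))
     = (\<integral>\<^sup>+z. (\<Prod>i\<in>UNIV. ennreal (exp (- \<bar>z $ i\<bar>))) \<partial>(lborel :: (real ^ 'k) measure))"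
    by (simp add: prod_ennreal exp_sum sum_negf[symmetric])
  also have "\<dots> = (\<Prod>i\<in>(UNIV :: 'k set). 2)"
    by (subst nn_integral_prod_vec) (auto simp: h)
  finally show ?thesis by (simp add: ennreal_power[symmetric])
qed

text \<open>The factorials in the Laplace integrals of \<open>N\<close> and of the \<open>\<ell>\<^sub>1\<close> norm cancel.\<close>

lemma measure_le_if_nn_integral_exp_le:
  fixes N :: "real ^ 'k \<Rightarrow> real"
  assumes [measurable]: "N \<in> borel_measurable borel" and nn: "\<And>x. N x \<ge> 0"
    and hom: "\<And>t x. t > 0 \<Longrightarrow> N (t *\<^sub>R x) = t * N x"
    and le: "(\<integral>\<^sup>+z. ennreal (exp (- N z)) \<partial>lborel) \<le> ennreal (2 ^ CARD('k) * W)" and W: "W \<ge> 0"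
  shows "measure lborel {z. N z \<le> 1} \<le> measure lborel (ell1_ball :: (real ^ 'k) set) * W"
proof -
  have 1: "ennreal (fact CARD('k)) * emeasure lborel {z. N z \<le> 1} \<le> ennreal (2 ^ CARD('k) * W)"
    using nn_integral_exp_neg_homogeneous[of N, OF assms(1) nn hom] le by simp
  have fact: "ennreal (fact CARD('k)) \<noteq> 0" "ennreal (fact CARD('k)) \<noteq> \<top>" by auto
  have "emeasure lborel {z. N z \<le> 1} \<noteq> \<top>"
  proof
    assume "emeasure lborel {z. N z \<le> 1} = \<top>"
    then show False using 1 fact by (simp add: ennreal_mult_top top_unique)
  qed
  then have 2: "fact CARD('k) * measure lborel {z. N z \<le> 1} \<le> 2 ^ CARD('k) * W"
    using 1 W by (simp add: emeasure_eq_ennreal_measure ennreal_mult[symmetric] del: ennreal_fact)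
  have "(\<lambda>z :: real ^ 'k. \<Sum>i\<in>UNIV. \<bar>z $ i\<bar>) \<in> borel_measurable borel" by measurable
  from nn_integral_exp_neg_homogeneous[OF this]
  have 3: "ennreal (fact CARD('k)) * emeasure lborel (ell1_ball :: (real ^ 'k) set) = ennreal (2 ^ CARD('k))"
    unfolding nn_integral_exp_ell1 by (simp add: ell1_ball_def abs_mult sum_distrib_left sum_nonneg)
  have "emeasure lborel (ell1_ball :: (real ^ 'k) set) \<noteq> \<top>"
  proof
    assume "emeasure lborel (ell1_ball :: (real ^ 'k) set) = \<top>"
    then show False using 3 fact by (simp add: ennreal_mult_top)
  qed
  then have "ennreal (fact CARD('k) * measure lborel (ell1_ball :: (real ^ 'k) set)) = ennreal (2 ^ CARD('k))"
    using 3 by (simp add: emeasure_eq_ennreal_measure ennreal_mult)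
  then have 4: "fact CARD('k) * measure lborel (ell1_ball :: (real ^ 'k) set) = 2 ^ CARD('k)"
    by (subst (asm) ennreal_inj) auto
  have "fact CARD('k) * measure lborel {z. N z \<le> 1} \<le> fact CARD('k) * (measure lborel (ell1_ball :: (real ^ 'k) set) * W)"
    using 2 unfolding 4[symmetric] by (simp add: mult.assoc)
  then show ?thesis by (rule mult_left_le_imp_le) simp
qed

lemma nn_integral_le_if_gaussian_damped_le:
  fixes g :: "'a::euclidean_space \<Rightarrow> real"
  assumes [measurable]: "g \<in> borel_measurable borel" and g: "\<And>z. g z \<ge> 0"
    and le: "\<And>\<delta>. \<delta> > 0 \<Longrightarrow> (\<integral>\<^sup>+z. ennreal (exp (- pi * \<delta>\<^sup>2 * (norm z)\<^sup>2) * g z) \<partial>lborel) \<le> W"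
  shows "(\<integral>\<^sup>+z. ennreal (g z) \<partial>lborel) \<le> W"
proof (rule LIMSEQ_le_const2)
  let ?\<delta> = "\<lambda>m. 1 / real (Suc m)"
  show "(\<lambda>m. \<integral>\<^sup>+z. ennreal (exp (- pi * (?\<delta> m)\<^sup>2 * (norm z)\<^sup>2) * g z) \<partial>lborel) \<longlonglongrightarrow> (\<integral>\<^sup>+z. ennreal (g z) \<partial>lborel)"
  proof (rule nn_integral_LIMSEQ)
    show "incseq (\<lambda>m z. ennreal (exp (- pi * (?\<delta> m)\<^sup>2 * (norm z)\<^sup>2) * g z))"
    proof (intro incseq_SucI le_funI ennreal_leI mult_right_mono g)
      fix m z
      have "(?\<delta> (Suc m))\<^sup>2 \<le> (?\<delta> m)\<^sup>2" by (intro power_mono) (auto simp: frac_le)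
      then have "pi * (?\<delta> (Suc m))\<^sup>2 * (norm z)\<^sup>2 \<le> pi * (?\<delta> m)\<^sup>2 * (norm z)\<^sup>2"
        by (intro mult_right_mono mult_left_mono) auto
      then show "exp (- pi * (?\<delta> m)\<^sup>2 * (norm z)\<^sup>2) \<le> exp (- pi * (?\<delta> (Suc m))\<^sup>2 * (norm z)\<^sup>2)" by simp
    qed
    fix z
    have "?\<delta> \<longlonglongrightarrow> 0" by (rule LIMSEQ_Suc[OF lim_1_over_n])
    then have "(\<lambda>m. exp (- pi * (?\<delta> m)\<^sup>2 * (norm z)\<^sup>2) * g z) \<longlonglongrightarrow> exp (- pi * 0\<^sup>2 * (norm z)\<^sup>2) * g z"
      by (intro tendsto_intros)
    then show "(\<lambda>m. ennreal (exp (- pi * (?\<delta> m)\<^sup>2 * (norm z)\<^sup>2) * g z)) \<longlonglongrightarrow> ennreal (g z)"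
      by (intro tendsto_ennrealI) simp
  qed auto
qed (use le in auto)

text \<open>For an isometric embedding \<open>f\<close>, the map \<open>f \<circ> adjoint f\<close> is the orthogonal projection onto the range of
  \<open>f\<close>.\<close>

definition perp_range_proj :: "('a::euclidean_space \<Rightarrow> 'b::euclidean_space) \<Rightarrow> 'b \<Rightarrow> 'b"
  where "perp_range_proj f x = x - f (adjoint f x)"

context
  fixes f :: "real ^ 'k \<Rightarrow> real ^ 'n"
  assumes lin: "linear f" and iso: "\<And>z. norm (f z) = norm z"
begin

lemma adjoint_linear_inner: "linear (adjoint f)" "f z \<bullet> x = z \<bullet> adjoint f x"
  using adjoint_linear[OF lin] adjoint_works[OF lin] by auto

lemma adjoint_isometry: "adjoint f (f z) = z"
proof -
  have inner: "f x \<bullet> f y = x \<bullet> y" for x y by (simp add: dot_norm iso flip: linear_add[OF lin])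
  have "y \<bullet> (adjoint f (f z) - z) = 0" for y
    using adjoint_linear_inner(2)[of y "f z"] inner[of y z] by (simp add: inner_diff_right)
  then show ?thesis using inner_eq_zero_iff by (metis eq_iff_diff_eq_0)
qed

lemma projection_complement:
  "linear (perp_range_proj f)" "perp_range_proj f (perp_range_proj f x) = perp_range_proj f x" "perp_range_proj f x \<bullet> y = x \<bullet> perp_range_proj f y"
  "norm (adjoint f x) = norm (x - perp_range_proj f x)" "(norm (perp_range_proj f x))\<^sup>2 + (norm (adjoint f x))\<^sup>2 = (norm x)\<^sup>2"
proof -
  show l: "linear (perp_range_proj f)" unfolding perp_range_proj_def[abs_def]
    using linear_compose_sub[OF linear_id linear_compose[OF adjoint_linear_inner(1) lin]] by (simp add: o_def id_def)
  show i: "perp_range_proj f (perp_range_proj f x) = perp_range_proj f x" for x by (simp add: perp_range_proj_def adjoint_isometry linear_diff[OF lin] linear_diff[OF adjoint_linear_inner(1)] linear_0[OF lin])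
  show s: "perp_range_proj f x \<bullet> y = x \<bullet> perp_range_proj f y" for x y
    using adjoint_linear_inner(2)[of "adjoint f x" y] adjoint_linear_inner(2)[of "adjoint f y" x]
    by (simp add: perp_range_proj_def inner_diff_left inner_diff_right inner_commute)
  show n: "norm (adjoint f x) = norm (x - perp_range_proj f x)" by (simp add: perp_range_proj_def iso)
  show "(norm (perp_range_proj f x))\<^sup>2 + (norm (adjoint f x))\<^sup>2 = (norm x)\<^sup>2"
    using projection_pythagoras(1)[OF l i s, of 1 x x] by (simp add: n)
qed

text \<open>The trace of the projection onto the range of \<open>f\<close>, computed in the standard basis of either side.\<close>

lemma sum_norm_projection: "(\<Sum>j\<in>UNIV. 1 - (norm (perp_range_proj f (axis j 1)))\<^sup>2) = CARD('k)"
proof -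
  have "(\<Sum>j\<in>UNIV. 1 - (norm (perp_range_proj f (axis j 1)))\<^sup>2) = (\<Sum>j\<in>(UNIV :: 'n set). (norm (adjoint f (axis j 1)))\<^sup>2)"
    using projection_complement(5)[of "axis _ 1"] by (intro sum.cong refl) (simp add: algebra_simps)
  also have "\<dots> = (\<Sum>j\<in>UNIV. \<Sum>i\<in>UNIV. (f (axis i 1) $ j)\<^sup>2)"
  proof (intro sum.cong refl)
    fix j :: 'n
    have "adjoint f (axis j 1) $ i = f (axis i 1) $ j" for i
      using adjoint_linear_inner(2)[of "axis i 1" "axis j 1"] by (simp add: inner_axis inner_axis')
    then show "(norm (adjoint f (axis j 1)))\<^sup>2 = (\<Sum>i\<in>UNIV. (f (axis i 1) $ j)\<^sup>2)"
      by (simp add: norm_vec_square)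
  qed
  also have "\<dots> = (\<Sum>i\<in>(UNIV :: 'k set). (norm (f (axis i 1)))\<^sup>2)"
    unfolding norm_vec_square by (rule sum.swap)
  finally show ?thesis by (simp add: iso)
qed

text \<open>The Fourier identity turns the damped integral over the section into a
  Gaussian-weighted integral of Cauchy kernels, to which the Brascamp--Lieb inequality applies. All powers of \<open>\<delta>\<close> cancel.\<close>

lemma nn_integral_section_le:
  assumes P0: "\<And>j. perp_range_proj f (axis j 1) \<noteq> 0"
  defines "p \<equiv> \<lambda>j. norm (perp_range_proj f (axis j 1))"
  shows "(\<integral>\<^sup>+z. ennreal (exp (- (\<Sum>j\<in>UNIV. \<bar>f z $ j\<bar>))) \<partial>lborel)
    \<le> ennreal (2 ^ CARD('k) * (pi powr (- ((real CARD('n) - real CARD('k)) / 2))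
        * (\<Prod>j\<in>UNIV. (Gamma (1 / (p j)\<^sup>2 - 1 / 2) / (p j * Gamma (1 / (p j)\<^sup>2))) powr (p j)\<^sup>2)))"
    (is "_ \<le> ennreal (2 ^ CARD('k) * (?c * ?Q))")
proof -
  note pc = projection_complement
  have p0: "p j > 0" for j using P0 by (simp add: p_def)
  have p1: "p j \<le> 1" for j
    using projection_pythagoras(2)[OF pc(1-3), of "axis j 1"] by (simp add: p_def)
  have s1: "1 / (p j)\<^sup>2 \<ge> 1" for j
    using p0[of j] p1[of j] by (simp add: power_le_one)
  have sump: "(\<Sum>j\<in>UNIV. (p j)\<^sup>2) = real CARD('n) - real CARD('k)"
    using sum_norm_projection by (simp add: p_def sum_subtractf)
  define F where "F j t = (1 + t\<^sup>2) powr (- (1 / (p j)\<^sup>2))" for j and t :: real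
  have t1: "1 + t\<^sup>2 > 0" for t :: real using zero_le_power2[of t] by linarith
  have Fpos: "F j t > 0" for j t using t1[of t] by (simp add: F_def)
  have Fcont: "continuous_on UNIV (F j)" for j
    unfolding F_def using t1 by (intro continuous_intros) (metis less_irrefl)
  define I where "I j = sqrt pi * Gamma (1 / (p j)\<^sup>2 - 1 / 2) / Gamma (1 / (p j)\<^sup>2)" for j
  have G: "Gamma (1 / (p j)\<^sup>2 - 1 / 2) > 0" "Gamma (1 / (p j)\<^sup>2) > 0" for j
    using s1[of j] by (auto intro!: Gamma_real_pos)
  have "(\<integral>\<^sup>+t. ennreal (F j t) \<partial>lborel) = ennreal (I j)" for j
    unfolding F_def I_def by (rule nn_integral_cauchy_power) (use s1[of j] in linarith)
  moreover have "I j \<ge> 0" for j using G[of j] by (simp add: I_def)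
  moreover have [measurable]: "F j \<in> borel_measurable borel" for j
    by (intro borel_measurable_continuous_onI Fcont)
  ultimately have Fint: "integrable lborel (F j)" "integral\<^sup>L lborel (F j) = I j" for j
    using nn_integral_eq_integrable[of "F j" lborel "I j"] Fpos[THEN less_imp_le] by auto
  have Fp: "F j t powr (p j)\<^sup>2 = 1 / (1 + t\<^sup>2)" for j t
  proof -
    have "- (1 / (p j)\<^sup>2) * (p j)\<^sup>2 = - 1" using p0[of j] by simp
    then have "F j t powr (p j)\<^sup>2 = (1 + t\<^sup>2) powr (- 1)" unfolding F_def powr_powr by (simp only:)
    then show ?thesis using t1[of t] by (simp add: powr_minus divide_inverse)
  qed
  have [measurable]: "f \<in> borel_measurable borel"
    using lin by (intro borel_measurable_continuous_onI linear_continuous_on) (simp add: linear_conv_bounded_linear)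
  have [measurable]: "adjoint f \<in> borel_measurable borel"
    using adjoint_linear_inner(1) by (intro borel_measurable_continuous_onI linear_continuous_on) (simp add: linear_conv_bounded_linear)
  show ?thesis
  proof (rule nn_integral_le_if_gaussian_damped_le)
    fix \<delta> :: real assume \<delta>: "\<delta> > 0"
    \<comment> \<open>With this \<open>a\<close>, the weight \<open>exp (- \<pi> a\<^sup>2 \<parallel>\<xi> - P \<xi>\<parallel>\<^sup>2)\<close> is, up to a constant factor, the Fourier
    transform of the damping.\<close>
    define a where "a = 1 / (2 * pi * \<delta>)"
    have a: "a > 0" using \<delta> by (simp add: a_def)
    let ?h = "\<lambda>\<xi>. exp (- (norm (adjoint f \<xi>))\<^sup>2 / (4 * pi * \<delta>\<^sup>2)) * (\<Prod>j\<in>UNIV. 1 / (1 + (\<xi> $ j)\<^sup>2))"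
    have h: "exp (- pi * (norm (a *\<^sub>R (\<xi> - perp_range_proj f \<xi>)))\<^sup>2) * (\<Prod>j\<in>UNIV. F j (\<xi> $ j) powr (norm (perp_range_proj f (axis j 1)))\<^sup>2) = ?h \<xi>" for \<xi>
      using \<delta> Fp[unfolded p_def] by (simp add: pc(4)[symmetric] a_def power_divide power_mult_distrib power2_eq_square)
    have nnle: "(\<integral>\<^sup>+\<xi>. ennreal (?h \<xi>) \<partial>lborel) \<le> ennreal (a powr (- real CARD('k)) * (\<Prod>j\<in>UNIV. (I j / p j) powr (p j)\<^sup>2))"
      using brascamp_lieb_projection[OF pc(1-3) P0 a, of F, OF Fcont Fpos Fint(1)]
      unfolding h sum_norm_projection Fint(2) p_def .
    have hint: "integrable lborel ?h"
    proof (rule Bochner_Integration.integrable_bound[OF integrable_prod_cauchy])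
      show "AE \<xi> in lborel. norm (?h \<xi>) \<le> norm (\<Prod>j\<in>UNIV. 1 / (1 + (\<xi> $ j)\<^sup>2))"
        by (auto simp: abs_mult intro!: mult_left_le_one_le)
    qed measurable
    have hle: "(\<integral>\<xi>. ?h \<xi> \<partial>lborel) \<le> a powr (- real CARD('k)) * (\<Prod>j\<in>UNIV. (I j / p j) powr (p j)\<^sup>2)"
    proof -
      have "0 \<le> a powr (- real CARD('k)) * (\<Prod>j\<in>UNIV. (I j / p j) powr (p j)\<^sup>2)"
        by (intro mult_nonneg_nonneg prod_nonneg) auto
      moreover have "(\<integral>\<^sup>+\<xi>. ennreal (?h \<xi>) \<partial>lborel) = ennreal (\<integral>\<xi>. ?h \<xi> \<partial>lborel)"
        by (rule nn_integral_eq_integral[OF hint]) (auto intro!: AE_I2 mult_nonneg_nonneg prod_nonneg)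
      ultimately show ?thesis using nnle by (simp only: ennreal_le_iff)
    qed
    have zint: "integrable lborel (\<lambda>z. exp (- pi * \<delta>\<^sup>2 * (norm z)\<^sup>2) * exp (- (\<Sum>j\<in>UNIV. \<bar>f z $ j\<bar>)))"
      by (rule Bochner_Integration.integrable_bound[OF integrable_gaussian_vec[OF \<delta>]]) (auto simp: sum_nonneg)
    have "(\<integral>z. exp (- pi * \<delta>\<^sup>2 * (norm z)\<^sup>2) * exp (- (\<Sum>j\<in>UNIV. \<bar>f z $ j\<bar>)) \<partial>lborel)
       = (\<integral>\<xi>. ?h \<xi> \<partial>lborel) / (\<delta> ^ CARD('k) * pi ^ CARD('n))"
      using gaussian_section_fourier[OF lin \<delta>] \<delta> by (simp add: field_simps)
    also have "\<dots> \<le> a powr (- real CARD('k)) * (\<Prod>j\<in>UNIV. (I j / p j) powr (p j)\<^sup>2) / (\<delta> ^ CARD('k) * pi ^ CARD('n))"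
      using hle \<delta> by (intro divide_right_mono) auto
    also have "(\<Prod>j\<in>UNIV. (I j / p j) powr (p j)\<^sup>2) = pi powr ((real CARD('n) - real CARD('k)) / 2) * ?Q"
    proof -
      have "(I j / p j) powr (p j)\<^sup>2 = pi powr ((p j)\<^sup>2 / 2) * (Gamma (1 / (p j)\<^sup>2 - 1 / 2) / (p j * Gamma (1 / (p j)\<^sup>2))) powr (p j)\<^sup>2" for j
      proof -
        have "I j / p j = sqrt pi * (Gamma (1 / (p j)\<^sup>2 - 1 / 2) / (p j * Gamma (1 / (p j)\<^sup>2)))"
          by (simp add: I_def)
        then show ?thesis by (simp only: powr_mult powr_half_sqrt[symmetric, of pi] pi_ge_zero powr_powr) simp
      qed
      moreover have "(\<Prod>j\<in>UNIV. pi powr ((p j)\<^sup>2 / 2)) = pi powr ((real CARD('n) - real CARD('k)) / 2)"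
        by (simp add: powr_sum[symmetric] sum_divide_distrib[symmetric] sump)
      ultimately show ?thesis by (simp add: prod.distrib)
    qed
    also have "a powr (- real CARD('k)) = 2 ^ CARD('k) * pi powr real CARD('k) * \<delta> ^ CARD('k)"
      using \<delta> by (simp add: a_def powr_minus powr_realpow power_mult_distrib power_divide)
    also have "2 ^ CARD('k) * pi powr real CARD('k) * \<delta> ^ CARD('k) * (pi powr ((real CARD('n) - real CARD('k)) / 2) * ?Q) / (\<delta> ^ CARD('k) * pi ^ CARD('n))
      = 2 ^ CARD('k) * ((pi powr real CARD('k) * pi powr ((real CARD('n) - real CARD('k)) / 2) / pi powr real CARD('n)) * ?Q)"
      using \<delta> by (simp add: powr_realpow)
    also have "pi powr real CARD('k) * pi powr ((real CARD('n) - real CARD('k)) / 2) / pi powr real CARD('n) = ?c"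
      proof -
      have "real CARD('k) + (real CARD('n) - real CARD('k)) / 2 - real CARD('n) = - ((real CARD('n) - real CARD('k)) / 2)"
        by (simp add: field_simps)
      then show ?thesis unfolding powr_add[symmetric] powr_diff[symmetric] by (simp only:)
    qed
    finally show "(\<integral>\<^sup>+z. ennreal (exp (- pi * \<delta>\<^sup>2 * (norm z)\<^sup>2) * exp (- (\<Sum>j\<in>UNIV. \<bar>f z $ j\<bar>))) \<partial>lborel)
       \<le> ennreal (2 ^ CARD('k) * (?c * ?Q))"
      using zint by (subst nn_integral_eq_integral) (auto intro!: ennreal_leI)
  qed auto
qed

end

lemma gamma_factor_prod_le:
  fixes p :: "'n::finite \<Rightarrow> real"
  assumes p: "\<And>j. 0 < p j" "\<And>j. p j \<le> 1"
  shows "(\<Prod>j\<in>UNIV. (Gamma (1 / (p j)\<^sup>2 - 1 / 2) / (p j * Gamma (1 / (p j)\<^sup>2))) powr (p j)\<^sup>2)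
    \<le> pi powr ((\<Sum>j\<in>UNIV. (p j)\<^sup>2) / 2)"
proof -
  have "(\<Prod>j\<in>UNIV. (Gamma (1 / (p j)\<^sup>2 - 1 / 2) / (p j * Gamma (1 / (p j)\<^sup>2))) powr (p j)\<^sup>2)
    \<le> (\<Prod>j\<in>UNIV. pi powr ((p j)\<^sup>2 / 2))"
  proof (intro prod_mono conjI)
    fix j
    have s: "1 / (p j)\<^sup>2 \<ge> 1" using p[of j] by (simp add: power_le_one)
    have G: "Gamma (1 / (p j)\<^sup>2 - 1 / 2) > 0" "Gamma (1 / (p j)\<^sup>2) > 0"
      using s by (auto intro!: Gamma_real_pos)
    have "Gamma (1 / (p j)\<^sup>2 - 1 / 2) / (p j * Gamma (1 / (p j)\<^sup>2)) \<le> sqrt pi"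
      using Gamma_quotient_le[OF s] p(1)[of j] by (simp add: real_sqrt_divide)
    then have "(Gamma (1 / (p j)\<^sup>2 - 1 / 2) / (p j * Gamma (1 / (p j)\<^sup>2))) powr (p j)\<^sup>2 \<le> sqrt pi powr (p j)\<^sup>2"
      using G p(1)[of j] by (intro powr_mono2) auto
    also have "\<dots> = pi powr ((p j)\<^sup>2 / 2)"
      by (simp add: powr_half_sqrt[symmetric] powr_powr)
    finally show "(Gamma (1 / (p j)\<^sup>2 - 1 / 2) / (p j * Gamma (1 / (p j)\<^sup>2))) powr (p j)\<^sup>2 \<le> pi powr ((p j)\<^sup>2 / 2)" .
  qed simp
  then show ?thesis by (simp add: powr_sum[symmetric] sum_divide_distrib)
qed

theorem corollary34:
  fixes H :: "(real ^ 'n) set"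
  assumes "subspace H"
    and "dim H = CARD('k::finite)"
    and "\<And>j. axis j 1 \<notin> H \<union> H\<^sup>\<bottom>"
  shows
    "let p = (\<lambda>j. norm (orth_proj (H\<^sup>\<bottom>) (axis j 1)));
         V = measure lborel (ell1_ball :: (real ^ 'k) set);
         U = V * (1 / pi powr ((real CARD('n) - real CARD('k)) / 2))
               * (\<Prod>j\<in>UNIV. (Gamma (1 / (p j)\<^sup>2 - 1 / 2) / (p j * Gamma (1 / (p j)\<^sup>2))) powr (p j)\<^sup>2)
     in measure (subspace_lborel H) (ell1_ball \<inter> H) \<le> U \<and> U \<le> V"
proof -
  have d: "dim (UNIV :: (real ^ 'k) set) = dim H" using assms(2) by (simp add: dim_UNIV)
  obtain f :: "real ^ 'k \<Rightarrow> real ^ 'n" where lin: "linear f" and fH: "range f = H"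
    and iso': "\<And>z. z \<in> UNIV \<Longrightarrow> norm (f z) = norm z"
    by (rule isometries_subspaces[OF subspace_UNIV assms(1) d]) (rule that)
  note iso = iso'[OF UNIV_I]
  note pc = projection_complement[OF lin iso]
  have PH: "orth_proj (H\<^sup>\<bottom>) x = perp_range_proj f x" for x
  proof (rule orth_proj_unique)
    show "subspace (H\<^sup>\<bottom>)" by (rule subspace_orthogonal_comp)
    show "perp_range_proj f x \<in> H\<^sup>\<bottom>"
      unfolding orthogonal_comp_def orthogonal_def fH[symmetric]
      using adjoint_linear_inner(2)[OF lin iso] by (auto simp: perp_range_proj_def linear_diff[OF adjoint_linear[OF lin]] adjoint_isometry[OF lin iso])
    have "x - perp_range_proj f x \<in> H" using fH by (auto simp: perp_range_proj_def)
    then show "x - perp_range_proj f x \<in> H\<^sup>\<bottom>\<^sup>\<bottom>" by (auto simp: orthogonal_comp_def orthogonal_commute)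
  qed
  define p where "p j = norm (perp_range_proj f (axis j 1))" for j
  define Q where "Q = (\<Prod>j\<in>UNIV. (Gamma (1 / (p j)\<^sup>2 - 1 / 2) / (p j * Gamma (1 / (p j)\<^sup>2))) powr (p j)\<^sup>2)"
  define c where "c = pi powr ((real CARD('n) - real CARD('k)) / 2)"
  have P0: "perp_range_proj f (axis j 1) \<noteq> 0" for j
  proof
    assume "perp_range_proj f (axis j 1) = 0"
    then have "axis j 1 \<in> H" using fH by (auto simp: perp_range_proj_def)
    then show False using assms(3) by blast
  qed
  have p0: "p j > 0" and p1: "p j \<le> 1" for j
    using P0 projection_pythagoras(2)[OF pc(1-3), of "axis j 1"] by (auto simp: p_def)
  have Q0: "Q \<ge> 0" unfolding Q_def by (intro prod_nonneg) simp
  have c0: "c > 0" by (simp add: c_def)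
  have [measurable]: "f \<in> borel_measurable borel"
    using lin by (intro borel_measurable_continuous_onI linear_continuous_on) (simp add: linear_conv_bounded_linear)
  have cH: "closed H" using assms(1) by (rule closed_subspace)
  have [measurable]: "(ell1_ball :: (real ^ 'n) set) \<in> sets borel" unfolding ell1_ball_def by measurable
  have "measure (subspace_lborel H) (ell1_ball \<inter> H) = measure (distr lborel borel f) (ell1_ball \<inter> H)"
    by (simp only: subspace_lborel_eq_distr_isometry[OF lin iso fH])
  also have "\<dots> = measure lborel {z. (\<Sum>j\<in>UNIV. \<bar>f z $ j\<bar>) \<le> 1}"
    using cH fH by (subst measure_distr) (auto simp: ell1_ball_def intro!: arg_cong2[where f=measure])
  also have "\<dots> \<le> measure lborel (ell1_ball :: (real ^ 'k) set) * (inverse c * Q)"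
  proof (rule measure_le_if_nn_integral_exp_le)
    show "(\<integral>\<^sup>+z. ennreal (exp (- (\<Sum>j\<in>UNIV. \<bar>f z $ j\<bar>))) \<partial>lborel) \<le> ennreal (2 ^ CARD('k) * (inverse c * Q))"
      using nn_integral_section_le[OF lin iso, OF P0]
      unfolding p_def[symmetric] Q_def[symmetric] powr_minus c_def[symmetric] .
  qed (use c0 Q0 in \<open>auto simp: sum_nonneg linear_scale[OF lin] abs_mult sum_distrib_left\<close>)
  finally have 1: "measure (subspace_lborel H) (ell1_ball \<inter> H) \<le> measure lborel (ell1_ball :: (real ^ 'k) set) * (1 / c) * Q"
    by (simp add: divide_inverse mult.assoc)
  have "(\<Sum>j\<in>UNIV. (p j)\<^sup>2) = real CARD('n) - real CARD('k)"
    using sum_norm_projection[OF lin iso] by (simp add: p_def sum_subtractf)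
  then have "Q \<le> c" using gamma_factor_prod_le[of p, OF p0 p1] by (simp add: Q_def c_def)
  then have "(1 / c) * Q \<le> 1" using c0 by simp
  from mult_left_mono[OF this, of "measure lborel (ell1_ball :: (real ^ 'k) set)"]
  have 2: "measure lborel (ell1_ball :: (real ^ 'k) set) * (1 / c) * Q \<le> measure lborel (ell1_ball :: (real ^ 'k) set)"
    by simp
  show ?thesis
    using 1 2 unfolding Let_def PH p_def[symmetric] Q_def[symmetric] c_def[symmetric] by blast
qed

end
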